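(* Let $G$ be a chordal graph of diameter $3$ that is not a split graph, let $C$ be a maximal clique of $G$ that is a dominating set of $G$, let $\bar C=V(G)\setminus C$, and let $U=\{u\in C : |N(u)\cap \bar C|=2\}$. Then $G$ does not admit a HIST if and only if at least one of the following holds: 1. There exists $u^*\in C$ with $|N(u^* )\cap\bar C|\ge 3$, and for every $u\in C\setminus\{u^*\}$ we have $|N(u)\cap \bar C|=1$ and the unique neighbour of $u$ in $\bar C$ is a pendant vertex. 2. For every $u\in C$, $|N(u)\cap\bar C|\in\{1,2\}$; every vertex of $\bigcup_{u\in C\setminus U}(N(u)\cap\bar C)$ is a pendant vertex; and one of the following holds: (a) $|U|=1$; (b) $|U|=2$ and $\left|\bigcap_{u\in U}(N(u)\cap\bar C)\right|=1$; (c) $|U|\ge 3$, the sets $N(u)\cap\bar C$ for $u\in U$ are pairwise distinct, $\left|\bigcap_{u\in U}(N(u)\cap\bar C)\right|=1$, and the induced subgraph $G[\bar C]$ contains exactly one edge.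
   Context: All graphs are finite, simple and undirected; $N(u)$ denotes the set of neighbours of $u$ in $G$; a pendant vertex is a vertex of degree $1$ in $G$. A HIST (homeomorphically irreducible spanning tree) of a connected graph $G$ is a spanning tree of $G$ with no vertex of degree exactly $2$ in the tree. A graph is chordal if every cycle of length at least $4$ has a chord. A split graph is a graph whose vertex set can be partitioned into a clique and an independent set. A dominating set $D$ of $G$ is a vertex set such that every vertex outside $D$ has a neighbour in $D$. (Every chordal graph of diameter at most $3$ has a dominating clique, hence a maximal clique that is dominating.) *)

theory Defs
  imports Main "HOL-Library.Extended_Nat"
begin

text \<open>A graph is given by its vertex set and its set of edges, an edge being the two-element set
  of its ends.\<close>

definition simple_graph :: "'a set \<Rightarrow> 'a set set \<Rightarrow> bool" where
  "simple_graph V E \<longleftrightarrow> finite V \<and> (\<forall>e\<in>E. e \<subseteq> V \<and> card e = 2)"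

definition neighbours :: "'a set set \<Rightarrow> 'a \<Rightarrow> 'a set" where
  "neighbours E u = {v. {u, v} \<in> E}"

definition vertex_degree :: "'a set set \<Rightarrow> 'a \<Rightarrow> nat" where
  "vertex_degree E u = card (neighbours E u)"

definition pendant :: "'a set set \<Rightarrow> 'a \<Rightarrow> bool" where
  "pendant E v \<longleftrightarrow> vertex_degree E v = 1"

definition induced_edges :: "'a set set \<Rightarrow> 'a set \<Rightarrow> 'a set set" where
  "induced_edges E S = {e \<in> E. e \<subseteq> S}"

definition walk :: "'a set \<Rightarrow> 'a set set \<Rightarrow> 'a \<Rightarrow> 'a list \<Rightarrow> 'a \<Rightarrow> bool" where
  "walk V E u p v \<longleftrightarrow> p \<noteq> [] \<and> set p \<subseteq> V \<and> hd p = u \<and> last p = v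
     \<and> successively (\<lambda>x y. {x, y} \<in> E) p"

definition connected_graph :: "'a set \<Rightarrow> 'a set set \<Rightarrow> bool" where
  "connected_graph V E \<longleftrightarrow> V \<noteq> {} \<and> (\<forall>u\<in>V. \<forall>v\<in>V. \<exists>p. walk V E u p v)"

text \<open>Vertices in different components are at distance \<open>\<infinity>\<close>, so a finite diameter entails
  connectedness.\<close>

definition graph_dist :: "'a set \<Rightarrow> 'a set set \<Rightarrow> 'a \<Rightarrow> 'a \<Rightarrow> enat" where
  "graph_dist V E u v = (INF p\<in>{p. walk V E u p v}. enat (length p - 1))"

definition graph_diameter :: "'a set \<Rightarrow> 'a set set \<Rightarrow> enat" where
  "graph_diameter V E = (SUP u\<in>V. SUP v\<in>V. graph_dist V E u v)"

text \<open>A cycle is the list of its vertices in cyclic order, without repeating the first one.\<close>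

definition cycle_edges :: "'a list \<Rightarrow> 'a set set" where
  "cycle_edges c = {{c ! i, c ! (Suc i mod length c)} | i. i < length c}"

definition is_cycle :: "'a set set \<Rightarrow> 'a list \<Rightarrow> bool" where
  "is_cycle E c \<longleftrightarrow> 3 \<le> length c \<and> distinct c \<and> cycle_edges c \<subseteq> E"

definition is_chord :: "'a set set \<Rightarrow> 'a list \<Rightarrow> 'a set \<Rightarrow> bool" where
  "is_chord E c e \<longleftrightarrow> e \<in> E \<and> e \<subseteq> set c \<and> e \<notin> cycle_edges c"

definition chordal :: "'a set set \<Rightarrow> bool" where
  "chordal E \<longleftrightarrow> (\<forall>c. is_cycle E c \<and> 4 \<le> length c \<longrightarrow> (\<exists>e. is_chord E c e))"

definition clique :: "'a set \<Rightarrow> 'a set set \<Rightarrow> 'a set \<Rightarrow> bool" where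
  "clique V E K \<longleftrightarrow> K \<subseteq> V \<and> (\<forall>u\<in>K. \<forall>v\<in>K. u \<noteq> v \<longrightarrow> {u, v} \<in> E)"

definition maximal_clique :: "'a set \<Rightarrow> 'a set set \<Rightarrow> 'a set \<Rightarrow> bool" where
  "maximal_clique V E K \<longleftrightarrow> clique V E K \<and> (\<forall>K'. clique V E K' \<and> K \<subseteq> K' \<longrightarrow> K' = K)"

definition independent_set :: "'a set \<Rightarrow> 'a set set \<Rightarrow> 'a set \<Rightarrow> bool" where
  "independent_set V E I \<longleftrightarrow> I \<subseteq> V \<and> (\<forall>u\<in>I. \<forall>v\<in>I. {u, v} \<notin> E)"

definition split_graph :: "'a set \<Rightarrow> 'a set set \<Rightarrow> bool" where
  "split_graph V E \<longleftrightarrow>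
     (\<exists>K I. K \<union> I = V \<and> K \<inter> I = {} \<and> clique V E K \<and> independent_set V E I)"

definition dominating_set :: "'a set \<Rightarrow> 'a set set \<Rightarrow> 'a set \<Rightarrow> bool" where
  "dominating_set V E D \<longleftrightarrow> D \<subseteq> V \<and> (\<forall>v \<in> V - D. neighbours E v \<inter> D \<noteq> {})"

definition is_tree :: "'a set \<Rightarrow> 'a set set \<Rightarrow> bool" where
  "is_tree V T \<longleftrightarrow> simple_graph V T \<and> connected_graph V T \<and> (\<nexists>c. is_cycle T c)"

definition spanning_tree :: "'a set \<Rightarrow> 'a set set \<Rightarrow> 'a set set \<Rightarrow> bool" where
  "spanning_tree V E T \<longleftrightarrow> T \<subseteq> E \<and> is_tree V T"

definition HIST :: "'a set \<Rightarrow> 'a set set \<Rightarrow> 'a set set \<Rightarrow> bool" where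
  "HIST V E T \<longleftrightarrow> spanning_tree V E T \<and> (\<forall>v\<in>V. vertex_degree T v \<noteq> 2)"

end

theory Submission
  imports Defs
begin

text \<open>Distribute the vertices outside \<open>C\<close> among their neighbours in \<open>C\<close>. Since \<open>C\<close> is a clique, this
  extends to a HIST in which all vertices outside \<open>C\<close> are leaves as soon as at least two vertices of
  \<open>C\<close> receive a number of leaves different from \<open>1\<close>. As \<open>G\<close> is not split there is an edge \<open>ab\<close> outside
  \<open>C\<close>, and by chordality \<open>a\<close> and \<open>b\<close> have a common neighbour \<open>u \<in> C\<close>; start from a distribution giving
  both to \<open>u\<close>. If there is no HIST, then every other vertex of \<open>C\<close> receives exactly one leaf, and
  redistributing one or two leaves must not create a second exceptional vertex. If \<open>u\<close> receives at
  least three leaves, this forces condition 1. If it receives two, then every vertex \<open>v \<in> C\<close> has a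
  private neighbour \<open>y v\<close>, and there is only one further vertex \<open>x\<close> outside \<open>C\<close>. In this
  configuration a HIST has to hang at least two of the \<open>y v\<close> on \<open>x\<close>, because a forest cannot have all
  but one of its degrees at least \<open>2\<close>; this decides the remaining cases.\<close>

section \<open>Cardinalities and neighbourhoods\<close>

lemma two_le_card: "a \<in> A \<Longrightarrow> b \<in> A \<Longrightarrow> a \<noteq> b \<Longrightarrow> finite A \<Longrightarrow> 2 \<le> card A"
  using card_mono[of A "{a, b}"] by simp

lemma card_ge_2_mono: "2 \<le> card A \<Longrightarrow> A \<subseteq> B \<Longrightarrow> finite B \<Longrightarrow> 2 \<le> card B"
  using card_mono[of B A] by linarith

lemma neighbours_sym: "v \<in> neighbours E u \<longleftrightarrow> u \<in> neighbours E v"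
  by (simp add: neighbours_def insert_commute)

lemma simple_neighbours:
  assumes "simple_graph V E" "v \<in> neighbours E u"
  shows "u \<in> V" "v \<in> V" "u \<noteq> v"
  using assms unfolding simple_graph_def neighbours_def by (auto simp: card_2_iff)

lemma simple_finite_neighbours:
  assumes "simple_graph V E"
  shows "finite (neighbours E u)"
  by (rule finite_subset[of _ V])
     (use assms simple_neighbours(2)[OF assms] in \<open>auto simp: simple_graph_def\<close>)

subsection \<open>Trees and forests\<close>

lemma walk_append:
  assumes "walk V E u p v" "walk V E v q w"
  shows "\<exists>r. walk V E u r w"
proof -
  obtain q' where q: "q = v # q'" using assms(2) unfolding walk_def by (cases q) auto
  have "walk V E u (p @ q') w"
    using assms unfolding q walk_def
    by (cases q') (auto simp: successively_append_iff)
  thus ?thesis by blast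
qed

lemma walk_mono:
  assumes "walk V E u p v" "V \<subseteq> V'" "E \<subseteq> E'"
  shows "walk V' E' u p v"
  using assms unfolding walk_def by (auto elim: successively_mono)

text \<open>A walk from \<open>S\<close> to its complement leaves \<open>S\<close> somewhere.
  Applied below to very small sets \<open>S\<close>, it yields a tree edge leaving them.\<close>

lemma connected_cut:
  assumes "connected_graph V E" "S \<subseteq> V" "S \<noteq> {}" "S \<noteq> V"
  shows "\<exists>a\<in>S. \<exists>b\<in>V - S. b \<in> neighbours E a"
proof -
  obtain s t where s: "s \<in> S" "t \<in> V - S" using assms by blast
  then obtain p where p: "walk V E s p t" using assms unfolding connected_graph_def by blast
  have "\<exists>a\<in>S. \<exists>b\<in>V - S. {a, b} \<in> E"
    if "p \<noteq> []" "set p \<subseteq> V" "hd p \<in> S" "last p \<notin> S" "successively (\<lambda>x y. {x, y} \<in> E) p" for p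
    using that
  proof (induction p)
    case (Cons x p)
    show ?case
    proof (cases "p \<noteq> [] \<and> hd p \<in> S")
      case True
      with Cons show ?thesis by (cases p) auto
    next
      case False
      with Cons.prems have "p \<noteq> []" by auto
      with False Cons.prems have "{x, hd p} \<in> E" "hd p \<in> V - S" "x \<in> S"
        by (auto simp: successively_Cons)
      then show ?thesis by blast
    qed
  qed simp
  with p s show ?thesis unfolding walk_def neighbours_def by blast
qed

section \<open>Cycles and degrees in forests\<close>

lemma cycle_two_neighbours:
  assumes "is_cycle E c" "v \<in> set c"
  shows "\<exists>a b. a \<noteq> b \<and> a \<in> neighbours E v \<and> b \<in> neighbours E v"
proof -
  let ?n = "length c"
  have c: "3 \<le> ?n" "distinct c" and e: "\<And>i. i < ?n \<Longrightarrow> {c ! i, c ! (Suc i mod ?n)} \<in> E"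
    using assms unfolding is_cycle_def cycle_edges_def by auto
  obtain i where i: "i < ?n" "c ! i = v" using assms by (auto simp: in_set_conv_nth)
  \<comment> \<open>\<open>j\<close> is the cyclic predecessor of \<open>i\<close>; it differs from
    the successor because a cycle has at least three vertices.\<close>
  define j where "j = (if i = 0 then ?n - 1 else i - 1)"
  have j: "j < ?n" "Suc j mod ?n = i" using i c by (auto simp: j_def)
  have ne: "Suc i mod ?n \<noteq> j" using i c by (auto simp: j_def mod_Suc)
  have "Suc i mod ?n < ?n" using c by (intro mod_less_divisor) auto
  then have "c ! (Suc i mod ?n) \<noteq> c ! j" using ne j c by (simp add: nth_eq_iff_index_eq)
  moreover have "c ! (Suc i mod ?n) \<in> neighbours E v" using e[OF i(1)] i by (simp add: neighbours_def)
  moreover have "c ! j \<in> neighbours E v" using e[OF j(1)] i j by (simp add: neighbours_def insert_commute)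
  ultimately show ?thesis by blast
qed

lemma cycle_edges_4: "cycle_edges [a, b, c, d] = {{a, b}, {b, c}, {c, d}, {d, a}}"
proof -
  have *: "i < length [a, b, c, d] \<longleftrightarrow> i = 0 \<or> i = 1 \<or> i = 2 \<or> i = 3" for i by auto
  have "{f i |i. i < length [a, b, c, d]} = {f 0, f 1, f 2, f 3}" for f :: "nat \<Rightarrow> 'a set"
    unfolding * by auto
  note this[of "\<lambda>i. {[a, b, c, d] ! i, [a, b, c, d] ! (Suc i mod length [a, b, c, d])}"]
  then show ?thesis unfolding cycle_edges_def by (simp add: nth_Cons')
qed

text \<open>An edge from position \<open>j\<close> back to the start closes the initial segment;
  \<open>2 \<le> j\<close> gives it at least three vertices.\<close>

lemma path_chord_cycle:
  assumes "distinct p" "successively (\<lambda>x y. {x, y} \<in> E) p" "2 \<le> j" "j < length p" "{p ! j, p ! 0} \<in> E"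
  shows "is_cycle E (take (Suc j) p)"
proof -
  have "{p ! i, p ! Suc i} \<in> E" if "Suc i < length p" for i
    using assms(2) that by (simp add: successively_conv_nth)
  then have "{take (Suc j) p ! i, take (Suc j) p ! (Suc i mod Suc j)} \<in> E" if "i < Suc j" for i
    using assms that by (cases "i = j") auto
  then show ?thesis
    using assms unfolding is_cycle_def cycle_edges_def by auto
qed

text \<open>Take a longest path in \<open>R\<close> ending in \<open>z\<close>. Its first vertex is
  not \<open>z\<close>, so it has a neighbour in \<open>R\<close> besides the next path vertex; this
  neighbour either prolongs the path or closes a cycle.\<close>

lemma acyclic_min_degree_aux:
  assumes fin: "finite R" and ac: "\<nexists>c. is_cycle T c"
    and z: "z \<in> R" "s \<in> R" "s \<in> neighbours T z" "s \<noteq> z"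
    and deg: "\<And>u. u \<in> R - {z} \<Longrightarrow> 2 \<le> card (neighbours T u \<inter> R - {u})"
  shows False
proof -
  define P where "P p \<longleftrightarrow> distinct p \<and> set p \<subseteq> R \<and> 2 \<le> length p \<and> last p = z
    \<and> successively (\<lambda>x y. {x, y} \<in> T) p" for p
  have "P [s, z]" using z by (auto simp: P_def neighbours_def insert_commute)
  moreover have bound: "length p \<le> card R" if "P p" for p
    using that fin card_mono distinct_card unfolding P_def by metis
  ultimately obtain p where p: "P p" and max: "\<And>q. P q \<Longrightarrow> length q \<le> length p"
    using ex_has_greatest_nat[of P "[s, z]" length "Suc (card R)"] by (auto simp: less_Suc_eq_le)
  obtain a b r where pab: "p = a # b # r"
    using p unfolding P_def by (cases p; cases "tl p") auto
  have "a \<noteq> z" using p last_in_set[of "b # r"] unfolding P_def pab by auto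
  then have "2 \<le> card (neighbours T a \<inter> R - {a})" using deg p unfolding P_def pab by auto
  then have "\<not> neighbours T a \<inter> R - {a} \<subseteq> {b}"
    using card_mono[of "{b}" "neighbours T a \<inter> R - {a}"] by auto
  then obtain n where n: "n \<in> neighbours T a" "n \<in> R" "n \<noteq> a" "n \<noteq> b" by auto
  show False
  proof (cases "n \<in> set p")
    case False
    then have "P (n # p)" using p n by (auto simp: P_def pab neighbours_def insert_commute)
    from max[OF this] show False by simp
  next
    case True
    then obtain j where j: "j < length p" "p ! j = n" by (auto simp: in_set_conv_nth)
    moreover have "2 \<le> j" using j n by (cases j; cases "j - 1") (auto simp: pab)
    ultimately have "is_cycle T (take (Suc j) p)"
      using path_chord_cycle[of p T j] p n
      by (auto simp: P_def pab neighbours_def insert_commute)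
    then show False using ac by blast
  qed
qed

text \<open>The exceptional vertex \<open>z\<close> may lie outside \<open>R\<close>; then all degrees in \<open>R\<close> are at least \<open>2\<close>.\<close>

lemma acyclic_min_degree:
  assumes fin: "finite R" and ac: "\<nexists>c. is_cycle T c" and si: "simple_graph V T"
    and ne: "R - {z} \<noteq> {}"
    and deg: "\<And>u. u \<in> R - {z} \<Longrightarrow> 2 \<le> card (neighbours T u \<inter> R)"
  shows False
proof (cases "z \<in> R \<and> neighbours T z \<inter> R \<noteq> {}")
  case True
  then obtain s where s: "s \<in> R" "s \<in> neighbours T z" by auto
  have *: "neighbours T u \<inter> R - {u} = neighbours T u \<inter> R" for u
    using simple_neighbours(3)[OF si] by blast
  show False
    by (rule acyclic_min_degree_aux[OF fin ac, of z s])
       (use True s deg simple_neighbours(3)[OF si s(2)] in \<open>auto simp: *\<close>)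
next
  case False
  \<comment> \<open>\<open>z\<close> is outside \<open>R\<close> or has no neighbour in it. Deleting
    it lowers no other degree, and any remaining \<open>u\<close> can serve as the end of the
    path.\<close>
  let ?R = "R - {z}"
  have *: "neighbours T u \<inter> ?R - {u} = neighbours T u \<inter> R" if "u \<in> ?R" for u
    using simple_neighbours(3)[OF si] False that neighbours_sym[of z T u] by blast
  obtain u where u: "u \<in> ?R" using ne by auto
  have "neighbours T u \<inter> R \<noteq> {}" using deg[OF u] by auto
  then obtain s where "s \<in> neighbours T u" "s \<in> ?R" "s \<noteq> u" using *[OF u] by blast
  with u show False
    using acyclic_min_degree_aux[of ?R T u s] fin ac deg * by (metis DiffD1 finite_Diff)
qed

text \<open>Every tree constructed here grows from a single vertex by this operation:
  \<open>W\<close> is the set of new leaves and \<open>f\<close> gives their parents.\<close>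

lemma attach_leaves:
  fixes f :: "'a \<Rightarrow> 'a"
  assumes tree: "is_tree V T" and W: "finite W" "W \<inter> V = {}" and fV: "f ` W \<subseteq> V"
  defines "T' \<equiv> T \<union> (\<lambda>w. {w, f w}) ` W"
  shows attach_leaves_tree: "is_tree (V \<union> W) T'"
    and attach_leaves_degree: "\<And>v. v \<in> V \<Longrightarrow> vertex_degree T' v = vertex_degree T v + card {w \<in> W. f w = v}"
    and attach_leaves_leaf: "\<And>w. w \<in> W \<Longrightarrow> vertex_degree T' w = 1"
proof -
  have f: "f w \<in> V" if "w \<in> W" for w using fV that by blast
  have si: "simple_graph V T" and co: "connected_graph V T" and ac: "\<nexists>c. is_cycle T c"
    using tree unfolding is_tree_def by auto
  have nV: "neighbours T' v = neighbours T v \<union> {w \<in> W. f w = v}" if "v \<in> V" for v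
  proof -
    have "v \<notin> W" using that W by auto
    then show ?thesis unfolding T'_def neighbours_def by (auto simp: doubleton_eq_iff)
  qed
  have nW: "neighbours T' w = {f w}" if "w \<in> W" for w
  proof -
    have "w \<notin> V" using that W by auto
    then have "neighbours T w = {}" using simple_neighbours(1)[OF si] by blast
    show ?thesis
    proof -
      have "\<forall>v\<in>W. f v \<noteq> w" using f \<open>w \<notin> V\<close> by auto
      with \<open>neighbours T w = {}\<close> \<open>w \<in> W\<close> show ?thesis
        unfolding T'_def neighbours_def by (auto simp: doubleton_eq_iff)
    qed
  qed
  show "vertex_degree T' v = vertex_degree T v + card {w \<in> W. f w = v}" if "v \<in> V" for v
    unfolding vertex_degree_def nV[OF that]
    using simple_finite_neighbours[OF si] simple_neighbours(2)[OF si] W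
    by (intro card_Un_disjoint) auto
  show "vertex_degree T' w = 1" if "w \<in> W" for w
    unfolding vertex_degree_def nW[OF that] by simp
  have "simple_graph (V \<union> W) T'"
    using si W f unfolding simple_graph_def T'_def
    by (auto simp: card_2_iff) (metis disjoint_iff)
  moreover have "connected_graph (V \<union> W) T'"
  proof -
    define g where "g v = (if v \<in> W then f v else v)" for v
    have g: "\<exists>p. walk (V \<union> W) T' v p (g v)" "\<exists>p. walk (V \<union> W) T' (g v) p v" "g v \<in> V"
      if "v \<in> V \<union> W" for v
    proof -
      show "g v \<in> V" using that f by (auto simp: g_def)
      have "walk (V \<union> W) T' v (if v \<in> W then [v, f v] else [v]) (g v)"
           "walk (V \<union> W) T' (g v) (if v \<in> W then [f v, v] else [v]) v"
        using that f by (auto simp: walk_def g_def T'_def insert_commute)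
      then show "\<exists>p. walk (V \<union> W) T' v p (g v)" "\<exists>p. walk (V \<union> W) T' (g v) p v" by blast+
    qed
    have "\<exists>p. walk (V \<union> W) T' a p b" if ab: "a \<in> V \<union> W" "b \<in> V \<union> W" for a b
    proof -
      obtain p where "walk V T (g a) p (g b)"
        using co g(3) ab unfolding connected_graph_def by blast
      then have "walk (V \<union> W) T' (g a) p (g b)" by (rule walk_mono) (auto simp: T'_def)
      then show ?thesis using g(1)[OF ab(1)] g(2)[OF ab(2)] walk_append by metis
    qed
    then show ?thesis using co unfolding connected_graph_def by blast
  qed
  moreover have "\<not> is_cycle T' c" for c
  proof
    assume c: "is_cycle T' c"
    have disj: "w \<notin> set c" if "w \<in> W" for w
      using cycle_two_neighbours[OF c, of w] nW[OF that] by auto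
    have "cycle_edges c \<subseteq> T"
    proof
      fix e assume e: "e \<in> cycle_edges c"
      then obtain i where i: "e = {c ! i, c ! (Suc i mod length c)}" "i < length c"
        unfolding cycle_edges_def by auto
      then have "Suc i mod length c < length c" by (intro mod_less_divisor) auto
      then have "e \<subseteq> set c" using i by auto
      moreover have "e \<in> T'" using c e unfolding is_cycle_def by blast
      ultimately show "e \<in> T" using disj unfolding T'_def by blast
    qed
    then have "is_cycle T c" using c unfolding is_cycle_def by blast
    then show False using ac by blast
  qed
  ultimately show "is_tree (V \<union> W) T'" unfolding is_tree_def by blast
qed

lemma singleton_tree:
  fixes v :: 'a
  shows "is_tree {v} {}" "vertex_degree {} u = 0"
proof -
  have "walk {v} {} v [v] v" by (simp add: walk_def)
  moreover have "\<not> is_cycle {} c" for c :: "'a list"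
    
  proof
    assume c: "is_cycle {} c"
    then have "c ! 0 \<in> set c" by (intro nth_mem) (auto simp: is_cycle_def)
    from cycle_two_neighbours[OF c this] show False by (simp add: neighbours_def)
  qed
  ultimately show "is_tree {v} {}"
    unfolding is_tree_def simple_graph_def connected_graph_def by auto
  show "vertex_degree {} u = 0" by (simp add: vertex_degree_def neighbours_def)
qed

text \<open>The tree is a path from \<open>p\<close> through \<open>B\<close>, and \<open>m\<close>
  is its far end, where the induction appends the next vertex. For empty \<open>B\<close> both ends
  coincide, whence the case distinctions.\<close>

lemma path_tree:
  assumes "finite B" "p \<notin> B"
  shows "\<exists>T m. is_tree (insert p B) T \<and> m \<in> insert p B \<and> (m = p \<longleftrightarrow> B = {})
    \<and> vertex_degree T p = (if B = {} then 0 else 1) \<and> (B \<noteq> {} \<longrightarrow> vertex_degree T m = 1)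
    \<and> (\<forall>v \<in> B - {m}. vertex_degree T v = 2)"
  using assms
proof (induction B rule: finite_induct)
  case empty
  show ?case by (intro exI[of _ "{}"] exI[of _ p]) (simp add: singleton_tree)
next
  case (insert b B)
  then obtain T m where T: "is_tree (insert p B) T" and m: "m \<in> insert p B" "m = p \<longleftrightarrow> B = {}"
    and d: "vertex_degree T p = (if B = {} then 0 else 1)" "B \<noteq> {} \<longrightarrow> vertex_degree T m = 1"
      "\<forall>v \<in> B - {m}. vertex_degree T v = 2"
    by auto
  note at = attach_leaves[OF T, of "{b}" "\<lambda>_. m"]
  define T' where "T' = T \<union> (\<lambda>w. {w, m}) ` {b}"
  have "is_tree (insert p B \<union> {b}) T'"
    unfolding T'_def by (rule at(1)) (use insert m in auto)
  moreover have "vertex_degree T' b = 1"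
    unfolding T'_def by (rule at(3)) (use insert m in auto)
  moreover have "vertex_degree T' v = vertex_degree T v + card {w \<in> {b}. m = v}"
    if "v \<in> insert p B" for v
    unfolding T'_def by (rule at(2)) (use insert m that in auto)
  then have "vertex_degree T' v = vertex_degree T v + (if v = m then 1 else 0)"
    if "v \<in> insert p B" for v
    using that by (cases "v = m") auto
  ultimately show ?case
    using insert m d by (intro exI[of _ T'] exI[of _ b]) (auto simp: insert_commute)
qed

text \<open>The tree is a broom: a path starting in \<open>p\<close> and running through \<open>B\<close>, with all remaining
  vertices attached to its last vertex.\<close>

lemma broom_tree:
  assumes "finite C" "p \<in> C" "q \<in> C" "p \<noteq> q" "B \<subseteq> C - {p, q}"
  obtains T where "is_tree C T" "\<And>v. v \<in> B \<Longrightarrow> 2 \<le> vertex_degree T v"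
    "\<And>v. v \<in> C - B - {p} \<Longrightarrow> vertex_degree T v = 1"
    "B \<noteq> {} \<Longrightarrow> vertex_degree T p = 1" "1 \<le> vertex_degree T p"
proof -
  have "finite B" "p \<notin> B" using assms finite_subset by auto
  then obtain T m where T: "is_tree (insert p B) T" and m: "m \<in> insert p B" "m = p \<longleftrightarrow> B = {}"
    and d: "vertex_degree T p = (if B = {} then 0 else 1)" "B \<noteq> {} \<longrightarrow> vertex_degree T m = 1"
      "\<forall>v \<in> B - {m}. vertex_degree T v = 2"
    using path_tree[of B p] by blast
  define W where "W = C - insert p B"
  have q: "q \<in> W" and W: "finite W" "W \<inter> insert p B = {}" "insert p B \<union> W = C"
    using assms by (auto simp: W_def)
  have mW: "(\<lambda>_. m) ` W \<subseteq> insert p B" using m by auto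
  note at = attach_leaves[OF T W(1,2) mW]
  define T' where "T' = T \<union> (\<lambda>w. {w, m}) ` W"
  have dm: "vertex_degree T' v = vertex_degree T v + card {w \<in> W. m = v}" if "v \<in> insert p B" for v
    unfolding T'_def by (rule at(2)[OF that])
  \<comment> \<open>\<open>q\<close> lies in \<open>W\<close>, so the far end \<open>m\<close> gains
    a leaf. This lifts its degree to at least \<open>2\<close> if it lies in \<open>B\<close>; if
    \<open>B\<close> is empty, the tree is a star around \<open>p\<close>.\<close>
  have "card W \<ge> 1" using q W by (simp add: card_gt_0_iff Suc_le_eq) blast
  have dv: "vertex_degree T' v = vertex_degree T v + (if m = v then card W else 0)"
    if "v \<in> insert p B" for v
    using dm[OF that] by simp
  show thesis
  proof (rule that)
    show "is_tree C T'" using at(1) unfolding T'_def W(3) .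
    show "vertex_degree T' v = 1" if "v \<in> C - B - {p}" for v
      unfolding T'_def by (rule at(3)) (use that in \<open>auto simp: W_def\<close>)
    show "2 \<le> vertex_degree T' v" if "v \<in> B" for v
      using dv[of v] that m d \<open>card W \<ge> 1\<close> by (cases "v = m") auto
    show "vertex_degree T' p = 1" if "B \<noteq> {}" using dv[of p] that m d by auto
    show "1 \<le> vertex_degree T' p" using dv[of p] m d \<open>card W \<ge> 1\<close> by auto
  qed
qed

section \<open>Leaves of a HIST\<close>

lemma HIST_neighbours_nonempty:
  assumes "HIST V E T" "w \<in> V" "V \<noteq> {w}"
  shows "neighbours T w \<noteq> {}"
proof -
  have "connected_graph V T" using assms unfolding HIST_def spanning_tree_def is_tree_def by auto
  then show ?thesis using connected_cut[of V T "{w}"] assms by auto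
qed

text \<open>The vertex carrying a leaf has degree at least \<open>2\<close>, as \<open>u\<close> and
  \<open>w\<close> are not the whole tree, and degree exactly \<open>2\<close> is forbidden. So at
  least two neighbours besides \<open>w\<close> remain.\<close>

lemma HIST_support_degree:
  assumes H: "HIST V E T" and w: "w \<in> V" "neighbours T w = {u}" and V: "V \<noteq> {u, w}"
  shows "2 \<le> card (neighbours T u - {w})"
proof -
  have si: "simple_graph V T" and co: "connected_graph V T"
    using H unfolding HIST_def spanning_tree_def is_tree_def by auto
  have "u \<in> neighbours T w" using w(2) by simp
  then have u: "u \<in> V" and wu: "w \<in> neighbours T u"
    using simple_neighbours(2)[OF si] neighbours_sym[of w T u] by auto
  have deg: "card (neighbours T u) \<noteq> 2"
    using H u unfolding HIST_def vertex_degree_def by auto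
  have "{u, w} \<subseteq> V" "{u, w} \<noteq> {}" "{u, w} \<noteq> V" using u w(1) V by auto
  from connected_cut[OF co this] obtain a b
    where ab: "a \<in> {u, w}" "b \<in> V - {u, w}" "b \<in> neighbours T a" by (elim bexE)
  then have "b \<in> neighbours T u" "b \<noteq> w" using w(2) by auto
  then have "{w, b} \<subseteq> neighbours T u" "card {w, b} = 2" using wu by auto
  then have "2 \<le> card (neighbours T u)"
    using card_mono[OF simple_finite_neighbours[OF si, of u], of "{w, b}"] by simp
  then show ?thesis using deg wu card_Diff_singleton[of w "neighbours T u"] by simp
qed

subsection \<open>Chordal graphs with a dominating maximal clique\<close>

locale dominating_clique =
  fixes V :: "'a set" and E :: "'a set set" and C :: "'a set"
  assumes simple: "simple_graph V E" and chordal: "chordal E"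
    and maximal: "maximal_clique V E C" and dominating: "dominating_set V E C"
begin

lemma finite_V: "finite V" and C_V: "C \<subseteq> V" and finite_C: "finite C"
  using simple maximal finite_subset[of C V]
  unfolding simple_graph_def maximal_clique_def clique_def by auto

lemma C_edge: "u \<in> C \<Longrightarrow> v \<in> C \<Longrightarrow> u \<noteq> v \<Longrightarrow> v \<in> neighbours E u"
  using maximal unfolding maximal_clique_def clique_def neighbours_def by auto

lemma neighbour_in_C: "w \<in> V - C \<Longrightarrow> neighbours E w \<inter> C \<noteq> {}"
  using dominating unfolding dominating_set_def by auto

lemma not_C_subset_neighbours:
  assumes "w \<in> V - C"
  shows "\<not> C \<subseteq> neighbours E w"
proof
  assume C: "C \<subseteq> neighbours E w"
  have "clique V E (insert w C)"
    using maximal assms C unfolding maximal_clique_def clique_def neighbours_def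
    by (auto simp: insert_commute)
  then show False using maximal assms unfolding maximal_clique_def by blast
qed

text \<open>If \<open>a\<close> saw only \<open>w\<close> and \<open>b\<close> only
  \<open>w'\<close>, then \<open>a\<close>, \<open>w\<close>, \<open>w'\<close>, \<open>b\<close>
  would form a 4-cycle whose two possible chords are both missing. Chordality is used through this
  lemma alone.\<close>

lemma neighbours_nested:
  assumes w: "w \<in> V - C" "w' \<in> V - C" "w' \<in> neighbours E w"
  shows "neighbours E w \<inter> C \<subseteq> neighbours E w' \<or> neighbours E w' \<inter> C \<subseteq> neighbours E w"
proof (rule ccontr)
  assume "\<not> ?thesis"
  then obtain a b where a: "a \<in> C" "a \<in> neighbours E w" "a \<notin> neighbours E w'"
    and b: "b \<in> C" "b \<in> neighbours E w'" "b \<notin> neighbours E w" by blast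
  let ?c = "[a, w, w', b]"
  have ne: "a \<noteq> b" "w \<noteq> w'" using a b w simple_neighbours(3)[OF simple] by auto
  note ce = cycle_edges_4[of a w w' b]
  have "is_cycle E ?c"
  proof -
    have "{a, w} \<in> E" "{w, w'} \<in> E" "{w', b} \<in> E" "{b, a} \<in> E"
      using a b w ne C_edge[of b a] by (simp_all add: neighbours_def insert_commute)
    moreover have "distinct ?c" using a b w ne by auto
    ultimately show ?thesis unfolding is_cycle_def ce by simp
  qed
  then have "\<exists>e. is_chord E ?c e" using chordal[unfolded chordal_def, rule_format, of ?c] by simp
  then obtain e where e: "e \<in> E" "e \<subseteq> set ?c" "e \<notin> {{a, w}, {w, w'}, {w', b}, {b, a}}"
    unfolding is_chord_def ce by blast
  then have "card e = 2" using simple unfolding simple_graph_def by auto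
  then obtain s t where st: "e = {s, t}" "s \<noteq> t" by (auto simp: card_2_iff)
  have "{a, w'} \<notin> E" "{b, w} \<notin> E" using a b by (simp_all add: neighbours_def insert_commute)
  moreover have "s \<in> {a, w, w', b}" "t \<in> {a, w, w', b}" using e(2) st by auto
  ultimately show False using e(1,3) st by (auto simp: insert_commute)
qed

section \<open>HISTs and assignments of outer vertices to \<open>C\<close>\<close>

lemma tree_on_C:
  assumes "is_tree C T"
  shows "T \<subseteq> E"
proof
  fix e assume "e \<in> T"
  then have "e \<subseteq> C" "card e = 2" using assms unfolding is_tree_def simple_graph_def by auto
  then obtain a b where "e = {a, b}" "a \<in> C" "b \<in> C" "a \<noteq> b" by (auto simp: card_2_iff)
  then show "e \<in> E" using C_edge[of a b] by (simp add: neighbours_def)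
qed

text \<open>A vertex receiving exactly one leaf, collected in \<open>B\<close>, needs degree at
  least \<open>2\<close> in the tree on \<open>C\<close>; any other may have degree \<open>1\<close>
  there, as \<open>1 + k\<close> is \<open>2\<close> only for \<open>k = 1\<close>. A broom realises
  such degrees once two vertices lie outside \<open>B\<close>.\<close>

lemma HIST_from_assignment:
  assumes f: "\<And>w. w \<in> V - C \<Longrightarrow> f w \<in> neighbours E w \<inter> C" and ne: "V - C \<noteq> {}"
    and pq: "p \<in> C" "q \<in> C" "p \<noteq> q" "card {w \<in> V - C. f w = p} \<noteq> 1" "card {w \<in> V - C. f w = q} \<noteq> 1"
  shows "\<exists>T. HIST V E T"
proof -
  define B where "B = {u \<in> C. card {w \<in> V - C. f w = u} = 1}"
  \<comment> \<open>If \<open>B\<close> is empty, the broom is a star whose centre \<open>p\<close>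
    may have any positive degree. Then \<open>p\<close> is chosen anew with at least two leaves, so
    that its total degree is at least \<open>3\<close>.\<close>
  have "\<exists>p q. p \<in> C \<and> q \<in> C \<and> p \<noteq> q \<and> p \<notin> B \<and> q \<notin> B
    \<and> (B = {} \<longrightarrow> 2 \<le> card {w \<in> V - C. f w = p})"
  proof (cases "B = {}")
    case True
    obtain w where w: "w \<in> V - C" using ne by auto
    have "f w \<in> C" using f[OF w] by auto
    moreover have "{v \<in> V - C. f v = f w} \<noteq> {}" using w by auto
    then have "card {v \<in> V - C. f v = f w} \<noteq> 0" using finite_V by auto
    then have "2 \<le> card {v \<in> V - C. f v = f w}" using True \<open>f w \<in> C\<close> unfolding B_def by fastforce
    moreover obtain q' where "q' \<in> C" "q' \<noteq> f w" using pq by metis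
    ultimately show ?thesis using True by blast
  qed (use pq in \<open>auto simp: B_def\<close>)
  then obtain p q where p: "p \<in> C" "q \<in> C" "p \<noteq> q" "p \<notin> B" "q \<notin> B"
    and p2: "B = {} \<Longrightarrow> 2 \<le> card {w \<in> V - C. f w = p}" by blast
  have "B \<subseteq> C - {p, q}" using p unfolding B_def by auto
  then obtain T where T: "is_tree C T" "\<And>v. v \<in> B \<Longrightarrow> 2 \<le> vertex_degree T v"
    "\<And>v. v \<in> C - B - {p} \<Longrightarrow> vertex_degree T v = 1"
    "B \<noteq> {} \<Longrightarrow> vertex_degree T p = 1" "1 \<le> vertex_degree T p"
    using broom_tree[OF finite_C p(1-3)] by metis
  have W: "finite (V - C)" "(V - C) \<inter> C = {}" "f ` (V - C) \<subseteq> C"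
    using finite_V f by (simp, blast, blast)
  note at = attach_leaves[OF T(1) W]
  define T' where "T' = T \<union> (\<lambda>w. {w, f w}) ` (V - C)"
  have "is_tree (C \<union> (V - C)) T'" unfolding T'_def by (rule at(1))
  then have "is_tree V T'" using C_V by (simp add: Un_absorb1)
  moreover have "T' \<subseteq> E" using tree_on_C[OF T(1)] f unfolding T'_def neighbours_def by auto
  moreover have "vertex_degree T' v \<noteq> 2" if "v \<in> V" for v
  proof (cases "v \<in> C")
    case True
    have "vertex_degree T' v = vertex_degree T v + card {w \<in> V - C. f w = v}"
      unfolding T'_def by (rule at(2)[OF True])
    moreover have "card {w \<in> V - C. f w = v} = 1 \<longleftrightarrow> v \<in> B" using True by (simp add: B_def)
    ultimately show ?thesis using T(2)[of v] T(3)[of v] T(4,5) p2 p True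
      by (cases "v \<in> B"; cases "v = p"; cases "B = {}") auto
  next
    case False
    have "vertex_degree T' v = 1"
      unfolding T'_def by (rule at(3)) (use False that in blast)
    then show ?thesis by simp
  qed
  ultimately show ?thesis unfolding HIST_def spanning_tree_def by blast
qed

text \<open>Each \<open>u\<close> in \<open>C\<close> other than \<open>u'\<close> carries a pendant
  vertex, a leaf of every HIST, so it has two further tree neighbours, which lie in
  \<open>C\<close>. Only \<open>u'\<close> may have smaller degree inside \<open>C\<close>, which no
  forest allows.\<close>

lemma no_HIST_one_free:
  assumes u': "u' \<in> C" "neighbours E u' \<inter> (V - C) \<noteq> {}"
    and pend: "\<And>u. u \<in> C - {u'} \<Longrightarrow> \<exists>w. neighbours E u \<inter> (V - C) = {w} \<and> pendant E w"
  shows "\<nexists>T. HIST V E T"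
proof
  assume "\<exists>T. HIST V E T"
  then obtain T where H: "HIST V E T" by blast
  then have T: "simple_graph V T" "T \<subseteq> E" "\<nexists>c. is_cycle T c"
    unfolding HIST_def spanning_tree_def is_tree_def by auto
  then have sub: "neighbours T u \<subseteq> neighbours E u" for u by (auto simp: neighbours_def)
  show False
  proof (rule acyclic_min_degree[OF finite_C T(3,1)])
    obtain w where "w \<in> V - C" "u' \<in> neighbours E w" using u' neighbours_sym[of _ E u'] by blast
    then show "C - {u'} \<noteq> {}" using not_C_subset_neighbours by blast
    fix u assume u: "u \<in> C - {u'}"
    then obtain w where w: "neighbours E u \<inter> (V - C) = {w}" "pendant E w" using pend by blast
    have wV: "w \<in> V" "w \<notin> C" using w by auto
    obtain t where "neighbours E w = {t}"
      using w unfolding pendant_def vertex_degree_def by (auto simp: card_1_singleton_iff)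
    then have "neighbours E w = {u}" using w neighbours_sym[of w E u] by auto
    moreover have "V \<noteq> {w}" using u C_V wV by auto
    ultimately have "neighbours T w = {u}"
      using HIST_neighbours_nonempty[OF H wV(1)] sub[of w] by (metis subset_singletonD)
    moreover have "u' \<in> V" "u' \<noteq> u" "u' \<noteq> w" using u u'(1) C_V wV by auto
    then have "V \<noteq> {u, w}" by auto
    ultimately have "2 \<le> card (neighbours T u - {w})" using HIST_support_degree[OF H] wV by blast
    moreover have "neighbours T u - {w} \<subseteq> neighbours T u \<inter> C"
      using w(1) sub[of u] simple_neighbours(2)[OF T(1), of _ u] by blast
    then have "card (neighbours T u - {w}) \<le> card (neighbours T u \<inter> C)"
      using finite_C by (intro card_mono) auto
    ultimately show "2 \<le> card (neighbours T u \<inter> C)" by linarith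
  qed
qed

end

subsection \<open>Private neighbours and one shared vertex\<close>

text \<open>This is the configuration behind condition 2. Only the edges at \<open>x\<close> remain
  undetermined, and \<open>U\<close> turns out to be the set of neighbours of \<open>x\<close> in
  \<open>C\<close>.\<close>

locale spiked_clique = dominating_clique +
  fixes x :: 'a and y :: "'a \<Rightarrow> 'a"
  assumes x: "x \<in> V - C" and inj_y: "inj_on y C" and y_x: "x \<notin> y ` C"
    and Cbar: "V - C = insert x (y ` C)"
    and y_C: "\<And>v. v \<in> C \<Longrightarrow> neighbours E (y v) \<inter> C = {v}"
begin

lemma y_V: "v \<in> C \<Longrightarrow> y v \<in> V" "v \<in> C \<Longrightarrow> y v \<notin> C" "v \<in> C \<Longrightarrow> y v \<noteq> x"
  using Cbar y_x by auto

lemma x_V: "x \<in> V" "x \<notin> C"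
  using x by auto

lemma V_eq: "V = insert x (C \<union> y ` C)"
  using Cbar C_V by auto

lemma nested_y:
  assumes "v \<in> C" "w \<in> V - C" "w \<in> neighbours E (y v)"
  shows "v \<in> neighbours E w"
proof -
  have "y v \<in> V - C" using y_V assms by blast
  from neighbours_nested[OF this assms(2,3)] show ?thesis
  proof
    assume "neighbours E w \<inter> C \<subseteq> neighbours E (y v)"
    then have "neighbours E w \<inter> C \<subseteq> {v}" using y_C[OF assms(1)] by (metis Int_lower2 le_inf_iff)
    then show ?thesis using neighbour_in_C[OF assms(2)] by auto
  qed (simp add: y_C[OF assms(1)])
qed

text \<open>Adjacent \<open>y v\<close> and \<open>y u\<close> would have nested neighbourhoods in
  \<open>C\<close>, but these are the distinct singletons \<open>{v}\<close> and
  \<open>{u}\<close>.\<close>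

lemma neighbours_y:
  assumes v: "v \<in> C"
  shows "neighbours E (y v) \<subseteq> {v, x}"
proof
  fix w assume w: "w \<in> neighbours E (y v)"
  have wV: "w \<in> V" "w \<noteq> y v" using simple_neighbours[OF simple w] by auto
  show "w \<in> {v, x}"
  proof (cases "w \<in> C")
    case False
    then have vw: "v \<in> neighbours E w" using nested_y[OF v _ w] wV(1) by blast
    have "w \<in> insert x (y ` C)" using False wV(1) Cbar by blast
    then consider "w = x" | u where "u \<in> C" "w = y u" by blast
    then show ?thesis
    proof cases
      case 2
      then have "v \<in> {u}" using vw v y_C[OF 2(1)] by blast
      then show ?thesis using 2 wV(2) by simp
    qed simp
  next
    case True
    then show ?thesis using w y_C[OF v] by blast
  qed
qed

lemma x_neighbour_y: "v \<in> C \<Longrightarrow> x \<in> neighbours E (y v) \<Longrightarrow> v \<in> neighbours E x"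
  using nested_y x by blast

lemma neighbours_x: "neighbours E x \<subseteq> C \<union> y ` C"
  using simple_neighbours(2,3)[OF simple, of _ x] V_eq by blast

lemma y_neighbour: "v \<in> C \<Longrightarrow> y v \<in> neighbours E v"
  using y_C[of v] neighbours_sym[of v E "y v"] by auto

lemma neighbours_C:
  assumes v: "v \<in> C"
  shows "neighbours E v \<inter> (V - C) = insert (y v) (if v \<in> neighbours E x then {x} else {})"
proof -
  have "y u \<notin> neighbours E v" if "u \<in> C" "u \<noteq> v" for u
    using y_C[of u] that v neighbours_sym[of "y u" E v] by auto
  then show ?thesis
    using y_neighbour[OF v] v neighbours_sym[of x E v] unfolding Cbar by auto
qed

lemma neighbours_C_subset:
  assumes "v \<in> C"
  shows "neighbours E v \<subseteq> insert (y v) (insert x C)"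
    and "v \<notin> neighbours E x \<Longrightarrow> neighbours E v \<subseteq> insert (y v) C"
proof -
  have "neighbours E v \<subseteq> (neighbours E v \<inter> (V - C)) \<union> C"
    using simple_neighbours(2)[OF simple] by blast
  then show "neighbours E v \<subseteq> insert (y v) (insert x C)"
    and "v \<notin> neighbours E x \<Longrightarrow> neighbours E v \<subseteq> insert (y v) C"
    unfolding neighbours_C[OF assms] by (auto split: if_splits)
qed

lemma outer_degree:
  assumes "v \<in> C"
  shows "card (neighbours E v \<inter> (V - C)) = (if v \<in> neighbours E x then 2 else 1)"
  using neighbours_C[OF assms] y_V(3)[OF assms] by simp

lemma U_eq: "{u \<in> C. card (neighbours E u \<inter> (V - C)) = 2} = neighbours E x \<inter> C"
  using outer_degree by (auto split: if_splits)

text \<open>No \<open>y v\<close> has tree degree \<open>2\<close>, so it is a leaf on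
  \<open>v\<close> or on \<open>x\<close>. In the first case \<open>v\<close> has two further tree
  neighbours in \<open>insert x C\<close>. If fewer than two of the \<open>y v\<close> hang on
  \<open>x\<close>, the forest on \<open>insert x C\<close> has at most one vertex of degree below
  \<open>2\<close>.\<close>

lemma two_free:
  assumes H: "HIST V E T"
  shows "\<exists>u1\<in>C. \<exists>u2\<in>C. u1 \<noteq> u2 \<and> neighbours T (y u1) = {x} \<and> neighbours T (y u2) = {x}"
proof -
  have T: "simple_graph V T" "T \<subseteq> E" "\<nexists>c. is_cycle T c"
    and deg: "\<And>v. v \<in> V \<Longrightarrow> card (neighbours T v) \<noteq> 2"
    using H unfolding HIST_def spanning_tree_def is_tree_def vertex_degree_def by auto
  have sub: "neighbours T u \<subseteq> neighbours E u" for u using T by (auto simp: neighbours_def)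
  have leaf: "neighbours T (y v) = {v} \<or> neighbours T (y v) = {x}" if v: "v \<in> C" for v
  proof -
    have "neighbours T (y v) \<noteq> {}"
      by (rule HIST_neighbours_nonempty[OF H]) (use y_V[OF v] x_V in auto)
    moreover have "neighbours T (y v) \<noteq> {v, x}"
      using deg[OF y_V(1)[OF v]] v x_V(2) by (metis card_2_iff)
    moreover have "neighbours T (y v) \<subseteq> {v, x}" using sub[of "y v"] neighbours_y[OF v] by blast
    ultimately show ?thesis by blast
  qed
  have deg_C: "2 \<le> card (neighbours T v \<inter> insert x C)" if v: "v \<in> C" "neighbours T (y v) = {v}" for v
  proof -
    have "2 \<le> card (neighbours T v - {y v})"
      by (rule HIST_support_degree[OF H]) (use v y_V x_V in auto)
    moreover have "neighbours T v - {y v} \<subseteq> neighbours T v \<inter> insert x C"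
      using neighbours_C_subset(1)[OF v(1)] sub[of v] by blast
    ultimately show ?thesis
      by (rule card_ge_2_mono) (use finite_C in auto)
  qed
  have C0: "C \<noteq> {}" using neighbour_in_C[OF x] by auto
  show ?thesis
  proof (rule ccontr)
    assume not: "\<not> ?thesis"
    show False
    proof (cases "\<exists>u\<in>C. neighbours T (y u) = {x}")
      case False
      then have "\<And>u. u \<in> C \<Longrightarrow> neighbours T (y u) = {u}" using leaf by blast
      then have "2 \<le> card (neighbours T u \<inter> insert x C)" if "u \<in> insert x C - {x}" for u
        using deg_C that by blast
      moreover have "finite (insert x C)" "insert x C - {x} \<noteq> {}" using finite_C C0 x_V by auto
      ultimately show False using acyclic_min_degree T(1,3) by metis
    next
      case True
      \<comment> \<open>Here \<open>u0\<close> is the exceptional vertex: \<open>x\<close> carries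
        the leaf \<open>y u0\<close>, so it has two further neighbours, and these lie in
        \<open>C\<close> because no other \<open>y u\<close> hangs on \<open>x\<close>.\<close>
      then obtain u0 where u0: "u0 \<in> C" "neighbours T (y u0) = {x}" by auto
      have yu: "neighbours T (y u) = {u}" if "u \<in> C" "u \<noteq> u0" for u
        using not leaf[OF that(1)] u0 that by blast
      have "u0 \<in> V" "u0 \<noteq> x" "u0 \<noteq> y u0" using u0(1) y_V[of u0] x_V C_V by auto
      then have "V \<noteq> {x, y u0}" by auto
      then have "2 \<le> card (neighbours T x - {y u0})"
        using HIST_support_degree[OF H y_V(1)[OF u0(1)] u0(2)] by simp
      moreover have "y u \<notin> neighbours T x" if "u \<in> C" "u \<noteq> u0" for u
      proof -
        have "x \<noteq> u" using that x_V by auto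
        then show ?thesis using yu[OF that] neighbours_sym[of "y u" T x] by simp
      qed
      then have "neighbours T x \<inter> y ` C \<subseteq> {y u0}" by fast
      then have "neighbours T x - {y u0} \<subseteq> neighbours T x \<inter> insert x C"
        using neighbours_x sub[of x] by blast
      ultimately have "2 \<le> card (neighbours T x \<inter> insert x C)"
        by (rule card_ge_2_mono) (use finite_C in auto)
      then have "2 \<le> card (neighbours T u \<inter> insert x C)" if "u \<in> insert x C - {u0}" for u
        using deg_C yu that by blast
      moreover have "finite (insert x C)" "insert x C - {u0} \<noteq> {}" using finite_C u0 x_V by auto
      ultimately show False using acyclic_min_degree T(1,3) by metis
    qed
  qed
qed

text \<open>Two of the \<open>y v\<close> must hang on \<open>x\<close>, and they belong to the two
  elements of \<open>U\<close>. The cases are whether the tree joins \<open>x\<close> to one, both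
  or neither of these elements.\<close>

lemma no_HIST_two:
  assumes U: "card (neighbours E x \<inter> C) = 2"
  shows "\<nexists>T. HIST V E T"
proof
  assume "\<exists>T. HIST V E T"
  then obtain T where H: "HIST V E T" by blast
  have T: "simple_graph V T" "T \<subseteq> E" "\<nexists>c. is_cycle T c" "connected_graph V T"
    and deg: "\<And>v. v \<in> V \<Longrightarrow> card (neighbours T v) \<noteq> 2"
    using H unfolding HIST_def spanning_tree_def is_tree_def vertex_degree_def by auto
  have sub: "neighbours T u \<subseteq> neighbours E u" for u using T by (auto simp: neighbours_def)
  obtain u1 u2 where u: "u1 \<in> C" "u2 \<in> C" "u1 \<noteq> u2"
    and y12: "neighbours T (y u1) = {x}" "neighbours T (y u2) = {x}"
    using two_free[OF H] by blast
  have "u1 \<in> neighbours E x" "u2 \<in> neighbours E x"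
    using x_neighbour_y u y12 sub by blast+
  then have Ueq: "neighbours E x \<inter> C = {u1, u2}"
    using U u finite_C card_subset_eq[of "neighbours E x \<inter> C" "{u1, u2}"] by auto
  have y_nT: "y u1 \<notin> neighbours T u1" "y u2 \<notin> neighbours T u2"
  proof -
    have "u1 \<noteq> x" "u2 \<noteq> x" using u x_V by auto
    then show "y u1 \<notin> neighbours T u1" "y u2 \<notin> neighbours T u2"
      using y12 neighbours_sym[of "y u1" T u1] neighbours_sym[of "y u2" T u2] by simp_all
  qed
  \<comment> \<open>Outside \<open>U\<close> the vertex \<open>y v\<close> is pendant, so
    \<open>v\<close> carries a leaf and has two tree neighbours in \<open>C\<close>.\<close>
  have rest: "2 \<le> card (neighbours T v \<inter> C)" "neighbours T v \<inter> insert x C \<subseteq> C"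
    "y v \<notin> neighbours T x" if v: "v \<in> C" "v \<noteq> u1" "v \<noteq> u2" for v
  proof -
    have nx: "v \<notin> neighbours E x" using v Ueq by auto
    then have "neighbours E (y v) \<subseteq> {v}" using neighbours_y[OF v(1)] x_neighbour_y[OF v(1)] by blast
    moreover have "neighbours T (y v) \<noteq> {}"
      by (rule HIST_neighbours_nonempty[OF H]) (use y_V[OF v(1)] x_V in auto)
    ultimately have yv: "neighbours T (y v) = {v}" using sub[of "y v"] by blast
    have "v \<noteq> x" using v x_V by auto
    then show "y v \<notin> neighbours T x" using yv neighbours_sym[of "y v" T x] by simp
    have n: "neighbours T v \<subseteq> insert (y v) C"
      using neighbours_C_subset(2)[OF v(1) nx] sub[of v] by blast
    then show "neighbours T v \<inter> insert x C \<subseteq> C" using y_V(3)[OF v(1)] by blast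
    have "2 \<le> card (neighbours T v - {y v})"
      by (rule HIST_support_degree[OF H _ yv]) (use v y_V[OF v(1)] x_V in auto)
    moreover have "neighbours T v - {y v} \<subseteq> neighbours T v \<inter> C" using n by blast
    ultimately show "2 \<le> card (neighbours T v \<inter> C)"
      by (rule card_ge_2_mono) (use finite_C in auto)
  qed
  have Tx: "neighbours T x \<subseteq> {u1, u2, y u1, y u2}" "y u1 \<in> neighbours T x" "y u2 \<in> neighbours T x"
  proof -
    show "neighbours T x \<subseteq> {u1, u2, y u1, y u2}"
    proof
      fix w assume w: "w \<in> neighbours T x"
      then have wE: "w \<in> neighbours E x" using sub[of x] by blast
      show "w \<in> {u1, u2, y u1, y u2}"
      proof (cases "w \<in> C")
        case True
        then show ?thesis using wE Ueq by blast
      next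
        case False
        then obtain v where "v \<in> C" "w = y v" using wE neighbours_x by blast
        then show ?thesis using rest(3)[of v] w by blast
      qed
    qed
    show "y u1 \<in> neighbours T x" "y u2 \<in> neighbours T x"
      using y12 neighbours_sym[of "y u1" T x] neighbours_sym[of "y u2" T x] by simp_all
  qed
  have mono: "2 \<le> card (neighbours T v \<inter> insert x C)" if "2 \<le> card (neighbours T v \<inter> C)" for v
    by (rule card_ge_2_mono[OF that]) (use finite_C in auto)
  have nC: "neighbours T v \<subseteq> insert x C" if "v \<in> {u1, u2}" for v
  proof -
    have "v \<in> C" "y v \<notin> neighbours T v" using that u y_nT by auto
    then show ?thesis using neighbours_C_subset(1)[of v] sub[of v] by blast
  qed
  \<comment> \<open>If \<open>x\<close> reaches \<open>C\<close> only through \<open>a\<close>,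
    connectedness gives \<open>a\<close> a tree neighbour besides \<open>x\<close>, hence degree at
    least \<open>3\<close> and two neighbours in \<open>C\<close>. Then \<open>b\<close> is the only
    possible exception in \<open>C\<close>.\<close>
  have one: False if ab: "{a, b} = {u1, u2}" "a \<in> neighbours T x" "b \<notin> neighbours T x" for a b
  proof -
    have ab': "a \<in> {u1, u2}" "b \<in> {u1, u2}" using ab(1) by blast+
    then have abC: "a \<in> C" "b \<in> C" using u by auto
    have "a \<noteq> b" using ab by blast
    have nx: "neighbours T x \<subseteq> {a, y u1, y u2}" using Tx(1) ab by blast
    let ?S = "{a, x, y u1, y u2}"
    have "b \<in> V" "b \<notin> ?S" using abC \<open>a \<noteq> b\<close> y_V(2) u x_V C_V by auto
    moreover have S: "?S \<subseteq> V" "?S \<noteq> {}" using abC y_V(1) u C_V x_V by auto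
    ultimately have "?S \<noteq> V" by blast
    from connected_cut[OF T(4) S this] obtain d c
      where d: "d \<in> ?S" and c: "c \<in> V - ?S" "c \<in> neighbours T d" by (elim bexE)
    have "d = a" using d c nx y12 by blast
    then have c: "c \<in> neighbours T a" "c \<noteq> x" using c by auto
    have "x \<in> neighbours T a" using ab neighbours_sym[of a T x] by auto
    then have "2 \<le> card (neighbours T a)"
      using c two_le_card[of c _ x] simple_finite_neighbours[OF T(1)] by blast
    then have "3 \<le> card (neighbours T a)" using deg[of a] abC C_V by fastforce
    then have "2 \<le> card (neighbours T a - {x})" using card_Diff_singleton[OF \<open>x \<in> neighbours T a\<close>] by linarith
    moreover have "neighbours T a - {x} \<subseteq> neighbours T a \<inter> C" using nC[OF ab'(1)] by blast
    ultimately have "2 \<le> card (neighbours T a \<inter> C)"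
      by (rule card_ge_2_mono) (use finite_C in auto)
    moreover have "v = a \<or> v \<noteq> u1 \<and> v \<noteq> u2" if "v \<in> C - {b}" for v
      using that ab(1) by blast
    ultimately have "2 \<le> card (neighbours T v \<inter> C)" if "v \<in> C - {b}" for v
      using rest(1)[of v] that by blast
    moreover have "C - {b} \<noteq> {}" using abC \<open>a \<noteq> b\<close> by blast
    ultimately show False using acyclic_min_degree finite_C T(3,1) by metis
  qed
  consider "u1 \<in> neighbours T x" "u2 \<in> neighbours T x" | "u1 \<notin> neighbours T x" "u2 \<notin> neighbours T x"
    using one[of u1 u2] one[of u2 u1] by auto
  then show False
  proof cases
    case 1
    have "{u1, u2} \<subseteq> neighbours T x \<inter> insert x C" using 1 u by auto
    then have x2: "2 \<le> card (neighbours T x \<inter> insert x C)"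
      using two_le_card[of u1 _ u2] finite_C u by simp
    \<comment> \<open>A tree neighbour of \<open>a\<close> in \<open>C\<close> would, together with
      \<open>x\<close>, give \<open>a\<close> degree at least \<open>2\<close> in
      \<open>insert x C\<close>, leaving \<open>b\<close> as the only exception.\<close>
    have only_x: "neighbours T a \<inter> C = {}" if ab: "{a, b} = {u1, u2}" for a b
    proof (rule ccontr)
      assume ne: "neighbours T a \<inter> C \<noteq> {}"
      have "a \<in> {u1, u2}" "b \<in> {u1, u2}" "a \<noteq> b"
        using ab u(3) by (auto simp: doubleton_eq_iff)
      then have ab': "a \<in> C" "b \<in> C" "a \<noteq> b" "x \<in> neighbours T a"
        using u 1 neighbours_sym[of x T a] by auto
      obtain c where "c \<in> neighbours T a \<inter> C" using ne by auto
      then have "{c, x} \<subseteq> neighbours T a \<inter> insert x C" "c \<noteq> x" using ab' x_V by auto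
      then have "2 \<le> card (neighbours T a \<inter> insert x C)"
        using two_le_card[of c _ x] finite_C by simp
      moreover have "v = x \<or> v = a \<or> v \<in> C \<and> v \<noteq> u1 \<and> v \<noteq> u2" if "v \<in> insert x C - {b}" for v
        using that ab(1) by blast
      ultimately have "2 \<le> card (neighbours T v \<inter> insert x C)" if "v \<in> insert x C - {b}" for v
        using that x2 mono[OF rest(1)[of v]] by blast
      moreover have "finite (insert x C)" "insert x C - {b} \<noteq> {}" using finite_C ab' by auto
      ultimately show False using acyclic_min_degree T(1,3) by metis
    qed
    have none: "neighbours T u1 \<inter> C = {}" "neighbours T u2 \<inter> C = {}"
      using only_x[of u1 u2] only_x[of u2 u1] by auto
    \<comment> \<open>\<open>u1\<close> and \<open>u2\<close> have no tree neighbours in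
      \<open>C\<close>, so deleting them costs the rest of \<open>C\<close> nothing. The rest is
      nonempty since \<open>x\<close> is not adjacent to all of \<open>C\<close>, and it contains no
      exceptional vertex.\<close>
    let ?R = "C - {u1, u2}"
    obtain v where v: "v \<in> ?R" using not_C_subset_neighbours[OF x] Ueq by blast
    have "neighbours T w \<inter> C = neighbours T w \<inter> ?R" if "w \<in> C" for w
    proof -
      have "u1 \<notin> neighbours T w" "u2 \<notin> neighbours T w"
        using none that neighbours_sym[of u1 T w] neighbours_sym[of u2 T w] by auto
      then show ?thesis by blast
    qed
    then have "2 \<le> card (neighbours T w \<inter> ?R)" if "w \<in> ?R - {x}" for w
      using rest(1)[of w] that by simp
    moreover have "finite ?R" "?R - {x} \<noteq> {}" using finite_C v x_V by auto
    ultimately show False using acyclic_min_degree T(1,3) by metis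
  next
    case 2
    then have nx: "neighbours T x = {y u1, y u2}" using Tx by auto
    let ?S = "{x, y u1, y u2}"
    have "u1 \<in> V" "u1 \<notin> ?S" using u y_V(2)[OF u(1)] y_V(2)[OF u(2)] x_V C_V by auto
    moreover have S: "?S \<subseteq> V" "?S \<noteq> {}" using y_V(1) u x_V by auto
    ultimately have "?S \<noteq> V" by blast
    from connected_cut[OF T(4) S this] show False using y12 nx by blast
  qed
qed

lemma HIST_two_edges:
  assumes u: "u1 \<in> C" "u2 \<in> C" "u1 \<noteq> u2" "x \<in> neighbours E (y u1)" "x \<in> neighbours E (y u2)"
    and u3: "u3 \<in> neighbours E x \<inter> C" "u3 \<noteq> u1" "u3 \<noteq> u2"
  shows "\<exists>T. HIST V E T"
proof -
  \<comment> \<open>\<open>y u1\<close> and \<open>y u2\<close> hang on \<open>x\<close>, which hangs on \<open>u3\<close>; \<open>u1\<close> and \<open>u2\<close> are leaves.\<close>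
  let ?B = "C - {u1, u2}"
  obtain T where T: "is_tree C T" "\<And>v. v \<in> ?B \<Longrightarrow> 2 \<le> vertex_degree T v"
    "\<And>v. v \<in> C - ?B - {u1} \<Longrightarrow> vertex_degree T v = 1"
    "?B \<noteq> {} \<Longrightarrow> vertex_degree T u1 = 1"
    using broom_tree[OF finite_C u(1-3) order_refl] by metis
  \<comment> \<open>Leaves are attached in two rounds because \<open>x\<close>, the parent of those
    in \<open>W2\<close>, is itself a new vertex of the first round.\<close>
  define W1 where "W1 = insert x (y ` ?B)"
  define W2 where "W2 = {y u1, y u2}"
  define f where "f w = (if w = x then u3 else the_inv_into C y w)" for w
  have fy: "f (y v) = v" if "v \<in> C" for v
    using that y_V the_inv_into_f_f[OF inj_y] by (auto simp: f_def)
  have fx: "f x = u3" by (simp add: f_def)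
  have W1: "finite W1" "W1 \<inter> C = {}" "f ` W1 \<subseteq> C"
    using finite_C y_V x_V fx fy u3 by (auto simp: W1_def)
  note at1 = attach_leaves[OF T(1) W1]
  define T1 where "T1 = T \<union> (\<lambda>w. {w, f w}) ` W1"
  have W2: "finite W2" "W2 \<inter> (C \<union> W1) = {}" "(\<lambda>_. x) ` W2 \<subseteq> C \<union> W1"
    using u y_V inj_y by (auto simp: W1_def W2_def inj_on_def)
  have T1: "is_tree (C \<union> W1) T1" using at1(1) by (simp add: T1_def)
  note at2 = attach_leaves[OF T1 W2]
  define T2 where "T2 = T1 \<union> (\<lambda>w. {w, x}) ` W2"
  have "(C \<union> W1) \<union> W2 = V" using u by (auto simp: V_eq W1_def W2_def)
  then have "is_tree V T2" using at2(1) by (simp add: T2_def)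
  moreover have "T2 \<subseteq> E"
  proof -
    have "{w, f w} \<in> E" if w: "w \<in> W1" for w
    proof (cases "w = x")
      case True
      then show ?thesis using u3 fx by (simp add: neighbours_def)
    next
      case False
      then obtain v where "v \<in> C" "w = y v" using w by (auto simp: W1_def)
      then show ?thesis using fy y_neighbour[of v] by (simp add: neighbours_def insert_commute)
    qed
    moreover have "{w, x} \<in> E" if "w \<in> W2" for w using that u by (auto simp: W2_def neighbours_def)
    ultimately show ?thesis using tree_on_C[OF T(1)] by (auto simp: T1_def T2_def)
  qed
  moreover have "vertex_degree T2 v \<noteq> 2" if v: "v \<in> V" for v
  proof -
    have d2: "vertex_degree T2 v = vertex_degree T1 v + card {w \<in> W2. x = v}" if "v \<in> C \<union> W1"
      using at2(2)[OF that] by (simp add: T2_def)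
    have d1: "vertex_degree T1 v = vertex_degree T v + card {w \<in> W1. f w = v}" if "v \<in> C"
      using at1(2)[OF that] by (simp add: T1_def)
    have d1': "vertex_degree T1 v = 1" if "v \<in> W1" using at1(3)[OF that] by (simp add: T1_def)
    consider "v \<in> ?B" | "v = u1 \<or> v = u2" | "v = x" | "v \<in> W1" "v \<noteq> x" | "v \<in> W2"
      using v unfolding V_eq W1_def W2_def by blast
    then show ?thesis
    proof cases
      case 1
      have "y v \<in> {w \<in> W1. f w = v}" using 1 fy by (auto simp: W1_def)
      then have "card {w \<in> W1. f w = v} \<noteq> 0" using W1(1) by auto
      moreover have "v \<noteq> x" using 1 x_V by auto
      moreover have "v \<in> C" using 1 by auto
      ultimately show ?thesis using d2 d1 T(2)[OF 1] by simp
    next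
      case 2
      have "f w \<noteq> v" if "w \<in> W1" for w
        using that 2 fy fx u3(2,3) by (auto simp: W1_def)
      then have "{w \<in> W1. f w = v} = {}" by blast
      then have "card {w \<in> W1. f w = v} = 0" by (simp only: card.empty)
      \<comment> \<open>\<open>u3\<close> witnesses that \<open>?B\<close> is nonempty, so the end
        \<open>u1\<close> of the broom has degree \<open>1\<close> too.\<close>
      moreover have "vertex_degree T v = 1" using 2 T(3)[of v] T(4) u(1-3) u3 by blast
      moreover have "v \<in> C" "v \<noteq> x" using 2 u x_V by auto
      ultimately show ?thesis using d1 d2 by simp
    next
      case 3
      have "y u1 \<noteq> y u2" using u(1-3) inj_on_eq_iff[OF inj_y] by blast
      then have "card W2 = 2" by (simp add: W2_def)
      then show ?thesis using d2 d1' 3 by (simp add: W1_def)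
    next
      case 4
      then show ?thesis using d2 d1' by simp
    next
      case 5
      then show ?thesis using at2(3)[OF 5] by (simp add: T2_def)
    qed
  qed
  ultimately show ?thesis unfolding HIST_def spanning_tree_def by blast
qed

text \<open>No two of the \<open>y v\<close> are adjacent, so every edge outside \<open>C\<close>
  ends in \<open>x\<close>. The edge count in condition 2(c) thus counts the \<open>v\<close> with
  \<open>y v\<close> adjacent to \<open>x\<close>.\<close>

lemma outer_edges: "induced_edges E (V - C) = (\<lambda>v. {x, y v}) ` {v \<in> C. x \<in> neighbours E (y v)}"
proof (intro equalityI subsetI)
  fix e assume e: "e \<in> induced_edges E (V - C)"
  then have "card e = 2" "e \<in> E" "e \<subseteq> V - C"
    using simple by (auto simp: induced_edges_def simple_graph_def)
  then obtain a b where ab: "e = {a, b}" "a \<noteq> b" by (auto simp: card_2_iff)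
  have "b \<in> neighbours E a" "a \<in> neighbours E b"
    using ab \<open>e \<in> E\<close> by (auto simp: neighbours_def insert_commute)
  moreover have "a \<in> insert x (y ` C)" "b \<in> insert x (y ` C)" using ab \<open>e \<subseteq> V - C\<close> Cbar by auto
  moreover have "a \<notin> C" "b \<notin> C" using ab \<open>e \<subseteq> V - C\<close> by auto
  ultimately show "e \<in> (\<lambda>v. {x, y v}) ` {v \<in> C. x \<in> neighbours E (y v)}"
    using neighbours_y ab y_V by (auto simp: insert_commute)
qed (use x y_V in \<open>auto simp: induced_edges_def neighbours_def insert_commute\<close>)

lemma inj_outer_edge: "inj_on (\<lambda>v. {x, y v}) C"
  using inj_y y_V by (auto simp: inj_on_def doubleton_eq_iff)

text \<open>The \<open>v\<close> with \<open>y v\<close> adjacent to \<open>x\<close> form a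
  nonempty subset \<open>?S\<close> of \<open>U\<close>. A HIST needs two elements of
  \<open>?S\<close> by \<open>two_free\<close> and excludes \<open>card U = 2\<close>; conversely,
  two elements of \<open>?S\<close> and a third of \<open>U\<close> yield one.\<close>

lemma no_HIST_iff:
  assumes edge: "induced_edges E (V - C) \<noteq> {}"
  defines "U \<equiv> neighbours E x \<inter> C"
  shows "(\<nexists>T. HIST V E T) \<longleftrightarrow>
    card U = 1 \<or> card U = 2 \<or> 3 \<le> card U \<and> card (induced_edges E (V - C)) = 1"
proof -
  let ?S = "{v \<in> C. x \<in> neighbours E (y v)}"
  have card_S: "card (induced_edges E (V - C)) = card ?S"
    unfolding outer_edges by (intro card_image inj_on_subset[OF inj_outer_edge]) auto
  have S_U: "?S \<subseteq> U" using x_neighbour_y by (auto simp: U_def)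
  have fin: "finite ?S" "finite U" using finite_C by (auto simp: U_def)
  have "?S \<noteq> {}" using edge unfolding outer_edges by blast
  then have pos: "card ?S \<noteq> 0" "card U \<noteq> 0" using fin S_U by auto
  have S2: "2 \<le> card ?S" if H: "HIST V E T" for T
  proof -
    obtain u1 u2 where u: "u1 \<in> C" "u2 \<in> C" "u1 \<noteq> u2"
      "neighbours T (y u1) = {x}" "neighbours T (y u2) = {x}"
      using two_free[OF H] by blast
    have "T \<subseteq> E" using H unfolding HIST_def spanning_tree_def by auto
    then have "{u1, u2} \<subseteq> ?S" using u by (auto simp: neighbours_def)
    then show ?thesis using two_le_card[of u1 ?S u2] fin u by blast
  qed
  have "\<nexists>T. HIST V E T" if "card U = 1 \<or> card ?S = 1"
    using S2 that card_mono[OF fin(2) S_U] by force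
  moreover have "\<nexists>T. HIST V E T" if "card U = 2" using no_HIST_two that U_def by blast
  moreover have "\<exists>T. HIST V E T" if card_US: "3 \<le> card U" "2 \<le> card ?S"
  proof -
    obtain u1 where u1: "u1 \<in> ?S" using \<open>?S \<noteq> {}\<close> by blast
    have "\<not> ?S \<subseteq> {u1}" using card_US(2) card_mono[of "{u1}" ?S] by auto
    then obtain u2 where u2: "u2 \<in> ?S" "u2 \<noteq> u1" by blast
    have "\<not> U \<subseteq> {u1, u2}" using card_US(1) card_mono[of "{u1, u2}" U] u2 by auto
    then obtain u3 where "u3 \<in> U" "u3 \<noteq> u1" "u3 \<noteq> u2" by blast
    then show ?thesis using HIST_two_edges[of u1 u2 u3] u1 u2 by (auto simp: U_def)
  qed
  moreover have "card U = 1 \<or> card U = 2 \<or> 3 \<le> card U" "card ?S = 1 \<or> 2 \<le> card ?S"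
    using pos by linarith+
  ultimately show ?thesis unfolding card_S by blast
qed

end

section \<open>Outer neighbourhoods of clique vertices\<close>

context spiked_clique
begin

text \<open>Each set in the intersection is \<open>{y u, x}\<close> and the \<open>y u\<close> are
  distinct, so two of them already meet in \<open>x\<close> only.\<close>

lemma Inter_outer:
  assumes "2 \<le> card (neighbours E x \<inter> C)"
  shows "(\<Inter>u \<in> neighbours E x \<inter> C. neighbours E u \<inter> (V - C)) = {x}"
proof -
  have n: "neighbours E u \<inter> (V - C) = {y u, x}" if "u \<in> neighbours E x \<inter> C" for u
    using neighbours_C[of u] that by simp
  have "neighbours E x \<inter> C \<noteq> {}" using assms by force
  then obtain a where a: "a \<in> neighbours E x \<inter> C" by blast
  have "\<not> neighbours E x \<inter> C \<subseteq> {a}"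
    using assms card_mono[of "{a}" "neighbours E x \<inter> C"] by auto
  then obtain b where ab: "a \<in> neighbours E x \<inter> C" "b \<in> neighbours E x \<inter> C" "a \<noteq> b"
    using a by blast
  then have "y a \<noteq> y b" using inj_on_eq_iff[OF inj_y] by blast
  moreover have "(\<Inter>u \<in> neighbours E x \<inter> C. neighbours E u \<inter> (V - C)) \<subseteq> {y a, x} \<inter> {y b, x}"
    using n[OF ab(1)] n[OF ab(2)] ab(1,2) by blast
  moreover have "x \<in> neighbours E u \<inter> (V - C)" if "u \<in> neighbours E x \<inter> C" for u
    using n[OF that] by simp
  ultimately show ?thesis by blast
qed

lemma inj_outer: "inj_on (\<lambda>u. neighbours E u \<inter> (V - C)) (neighbours E x \<inter> C)"
proof (rule inj_onI)
  fix u v assume u: "u \<in> neighbours E x \<inter> C" and v: "v \<in> neighbours E x \<inter> C"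
    and "neighbours E u \<inter> (V - C) = neighbours E v \<inter> (V - C)"
  then have "{y u, x} = {y v, x}" using neighbours_C[of u] neighbours_C[of v] by simp
  then have "y u = y v" using y_V(3)[of u] y_V(3)[of v] u v by (auto simp: doubleton_eq_iff)
  then show "u = v" using inj_y u v by (auto simp: inj_on_def)
qed

lemma outer_pendant:
  assumes v: "v \<in> C" "v \<notin> neighbours E x" and w: "w \<in> neighbours E v \<inter> (V - C)"
  shows "pendant E w"
proof -
  have "w = y v" using neighbours_C[OF v(1)] v(2) w by simp
  moreover have "neighbours E (y v) = {v}"
    using neighbours_y[OF v(1)] x_neighbour_y[OF v(1)] v(2) y_C[OF v(1)] by blast
  ultimately show ?thesis by (simp add: pendant_def vertex_degree_def)
qed

end

subsection \<open>The characterisation\<close>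

context dominating_clique
begin

text \<open>Condition 2 leads back to the configuration: \<open>y u\<close> is the outer neighbour
  of \<open>u\<close> other than \<open>x\<close>. These are distinct on \<open>U\<close> because
  the outer neighbourhoods are, and elsewhere because they are pendant.\<close>

lemma spiked_cliqueI:
  assumes deg: "\<And>u. u \<in> C \<Longrightarrow> card (neighbours E u \<inter> (V - C)) \<in> {1, 2}"
  defines "U \<equiv> {u \<in> C. card (neighbours E u \<inter> (V - C)) = 2}"
  assumes pend: "\<And>u w. u \<in> C - U \<Longrightarrow> w \<in> neighbours E u \<inter> (V - C) \<Longrightarrow> pendant E w"
    and inj: "inj_on (\<lambda>u. neighbours E u \<inter> (V - C)) U"
    and x: "\<And>u. u \<in> U \<Longrightarrow> x \<in> neighbours E u \<inter> (V - C)" and U: "U \<noteq> {}"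
  shows "\<exists>y. spiked_clique V E C x y"
proof -
  let ?N = "\<lambda>u. neighbours E u \<inter> (V - C)"
  have pend1: "v = u" if uvw: "u \<in> C - U" "w \<in> ?N u" "v \<in> neighbours E w" for u v w
  proof -
    obtain t where "neighbours E w = {t}"
      using pend[OF uvw(1,2)] unfolding pendant_def vertex_degree_def by (auto simp: card_1_singleton_iff)
    moreover have "u \<in> neighbours E w" using that(2) neighbours_sym[of w E u] by blast
    ultimately show ?thesis using that(3) by simp
  qed
  obtain u0 where u0: "u0 \<in> U" using U by blast
  have "\<exists>w. ?N u - {x} = {w}" if u: "u \<in> C" for u
  proof (cases "u \<in> U")
    case True
    then have "card (?N u - {x}) = 1" using x[OF True] by (simp add: U_def card_Diff_singleton)
    then show ?thesis by (auto simp: card_1_singleton_iff)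
  next
    case False
    then have "card (?N u) = 1" using deg[OF u] u by (auto simp: U_def)
    then obtain w where w: "?N u = {w}" by (auto simp: card_1_singleton_iff)
    \<comment> \<open>\<open>x\<close> is adjacent to \<open>u0\<close> in \<open>U\<close>; as an
      outer neighbour of \<open>u\<close> outside \<open>U\<close> it would be pendant, forcing
      \<open>u0\<close> to equal \<open>u\<close>.\<close>
    have "u0 \<in> neighbours E x" using x[OF u0] neighbours_sym[of x E u0] by blast
    then have "x \<notin> ?N u" using pend1[of u x u0] False u u0 by blast
    then show ?thesis using w by blast
  qed
  then obtain y where y: "\<And>u. u \<in> C \<Longrightarrow> ?N u - {x} = {y u}" by metis
  have yN: "y u \<in> ?N u" "y u \<noteq> x" if "u \<in> C" for u using y[OF that] by blast+
  have U_C: "U \<subseteq> C" by (auto simp: U_def)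
  have inj_y: "u = v" if uv: "u \<in> C" "v \<in> C" "y u = y v" for u v
  proof (cases "u \<in> U \<and> v \<in> U")
    case True
    then have "?N u = insert x (?N u - {x})" "?N v = insert x (?N v - {x})" using x by blast+
    then have "?N u = ?N v" using y uv by simp
    then show ?thesis using inj True by (simp add: inj_on_def)
  next
    case False
    have "u \<in> neighbours E (y u)" "v \<in> neighbours E (y u)"
      using yN(1)[OF uv(1)] yN(1)[OF uv(2)] uv(3) neighbours_sym[of "y u" E] by auto
    then show ?thesis using pend1[of u "y u" v] pend1[of v "y u" u] yN(1) uv False
      by (metis DiffI)
  qed
  have "spiked_clique V E C x y"
  proof unfold_locales
    show xV: "x \<in> V - C" using x[OF u0] by blast
    show "inj_on y C" using inj_y by (simp add: inj_on_def)
    show "x \<notin> y ` C" using yN(2) by fast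
    show "V - C = insert x (y ` C)"
    proof
      show "V - C \<subseteq> insert x (y ` C)"
      proof
        fix w assume w: "w \<in> V - C"
        then obtain v where v: "v \<in> C" "v \<in> neighbours E w" using neighbour_in_C by blast
        then have "w \<in> ?N v" using w neighbours_sym[of w E v] by blast
        then have "w = x \<or> w \<in> ?N v - {x}" by blast
        then show "w \<in> insert x (y ` C)" unfolding y[OF v(1)] using v(1) by blast
      qed
      show "insert x (y ` C) \<subseteq> V - C" using xV yN(1) by fast
    qed
    show "neighbours E (y v) \<inter> C = {v}" if v: "v \<in> C" for v
    proof -
      have "v \<in> neighbours E (y v)" using yN(1)[OF v] neighbours_sym[of "y v" E v] by simp
      moreover have "neighbours E (y v) \<inter> C \<subseteq> {v}"
      proof
        fix u assume "u \<in> neighbours E (y v) \<inter> C"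
        then have u: "u \<in> C" "u \<in> neighbours E (y v)" by simp_all
        have "y v \<in> ?N u - {x}" using u(2) yN[OF v] neighbours_sym[of "y v" E u] by simp
        then have "y u = y v" unfolding y[OF u(1)] by simp
        then have "u = v" by (rule inj_y[OF u(1) v])
        then show "u \<in> {v}" by simp
      qed
      ultimately show ?thesis using v by fast
    qed
  qed
  then show ?thesis by blast
qed

lemma no_HIST_cases:
  assumes edge: "induced_edges E (V - C) \<noteq> {}" and no: "\<nexists>T. HIST V E T"
  shows "(\<exists>u'\<in>C. 3 \<le> card (neighbours E u' \<inter> (V - C)) \<and>
      (\<forall>u \<in> C - {u'}. card (neighbours E u \<inter> (V - C)) = 1 \<and>
        (\<forall>w \<in> neighbours E u \<inter> (V - C). pendant E w)))
    \<or> (\<exists>x y. spiked_clique V E C x y)"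
proof -
  obtain a b where ab: "a \<in> V - C" "b \<in> V - C" "b \<in> neighbours E a" "a \<noteq> b"
  proof -
    obtain e where e: "e \<in> E" "e \<subseteq> V - C" using edge unfolding induced_edges_def by blast
    then have "card e = 2" using simple unfolding simple_graph_def by blast
    then obtain a b where "e = {a, b}" "a \<noteq> b" by (auto simp: card_2_iff)
    then show thesis using that[of a b] e by (simp add: neighbours_def)
  qed
  define assignment where "assignment f \<longleftrightarrow> (\<forall>w \<in> V - C. f w \<in> neighbours E w \<inter> C)" for f
  have key: False if f: "assignment f" and p: "p \<in> C" "card {w \<in> V - C. f w = p} \<noteq> 1"
    and q: "q \<in> C" "card {w \<in> V - C. f w = q} \<noteq> 1" and pq: "p \<noteq> q" for f p q
  proof -
    have "\<exists>T. HIST V E T"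
      by (rule HIST_from_assignment[OF _ _ p(1) q(1) pq p(2) q(2)])
         (use f ab(1) in \<open>unfold assignment_def, blast+\<close>)
    then show False using no by simp
  qed
  have key': False if f: "assignment f" and p: "p \<in> C" "{w \<in> V - C. f w = p} = {}"
    and q: "q \<in> C" "s \<in> V - C" "t \<in> V - C" "s \<noteq> t" "f s = q" "f t = q" for f p q s t
  proof -
    have st: "s \<in> {w \<in> V - C. f w = q}" "t \<in> {w \<in> V - C. f w = q}" using q(2,3,5,6) by simp_all
    then have "2 \<le> card {w \<in> V - C. f w = q}" using finite_V q(4) by (intro two_le_card[of s _ t]) simp_all
    moreover have "p \<noteq> q" using p(2) st(1) by (metis empty_iff)
    moreover have "card {w \<in> V - C. f w = p} = 0" using p(2) by (simp only: card.empty)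
    ultimately show False by (intro key[OF f p(1) _ q(1)]) simp_all
  qed
  \<comment> \<open>By nestedness, the neighbours in \<open>C\<close> of one of \<open>a\<close> and
    \<open>b\<close> are shared by the other.\<close>
  obtain u where u: "u \<in> C" "u \<in> neighbours E a" "u \<in> neighbours E b"
  proof -
    obtain c d where "c \<in> neighbours E a \<inter> C" "d \<in> neighbours E b \<inter> C"
      using neighbour_in_C[OF ab(1)] neighbour_in_C[OF ab(2)] by blast
    then show thesis using that[of c] that[of d] neighbours_nested[OF ab(1-3)] by blast
  qed
  have "\<forall>w \<in> V - C. \<exists>c. c \<in> neighbours E w \<inter> C" using neighbour_in_C by blast
  then obtain g where g: "\<forall>w \<in> V - C. g w \<in> neighbours E w \<inter> C" by metis
  define f where "f = g(a := u, b := u)"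
  have f: "assignment f" using g u unfolding assignment_def f_def by simp
  have f_ab: "f a = u" "f b = u" using ab by (simp_all add: f_def)
  have f_C: "f w \<in> C" "f w \<in> neighbours E w" if "w \<in> V - C" for w
    using f that unfolding assignment_def by blast+
  have upd: "assignment (h(w := c))" if "assignment h" "w \<in> V - C" "c \<in> neighbours E w \<inter> C" for h w c
    using that unfolding assignment_def by simp
  define F where "F v = {w \<in> V - C. f w = v}" for v
  have finF: "finite (F v)" for v using finite_V by (simp add: F_def)
  have u2: "2 \<le> card (F u)" by (rule two_le_card[of a _ b]) (use ab f_ab finF in \<open>auto simp: F_def\<close>)
  have F1: "card (F v) = 1" if "v \<in> C" "v \<noteq> u" for v
    using key[OF f, of v u] that u(1) u2 unfolding F_def by fastforce
  \<comment> \<open>Moving \<open>w\<close>, the only leaf of \<open>f w\<close>, to another parent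
    \<open>c\<close> would leave \<open>f w\<close> without leaves, while \<open>u\<close> keeps
    \<open>a\<close> and \<open>b\<close>.\<close>
  have only: "neighbours E w \<inter> C = {f w}" if w: "w \<in> V - C" "f w \<noteq> u" for w
  proof (rule ccontr)
    assume "neighbours E w \<inter> C \<noteq> {f w}"
    then obtain c where c: "c \<in> neighbours E w \<inter> C" "c \<noteq> f w" using f_C[OF w(1)] by blast
    obtain t where t: "F (f w) = {t}"
      using F1[OF f_C(1)[OF w(1)] w(2)] by (auto simp: card_1_singleton_iff)
    have "w \<in> F (f w)" using w(1) by (simp add: F_def)
    then have Fw: "F (f w) = {w}" using t by simp
    have "{t \<in> V - C. (f(w := c)) t = f w} \<subseteq> F (f w) - {w}" using c(2) by (auto simp: F_def)
    then have "{t \<in> V - C. (f(w := c)) t = f w} = {}" unfolding Fw by simp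
    moreover have "(f(w := c)) a = u" "(f(w := c)) b = u" using f_ab w(2) by auto
    ultimately show False
      by (rule key'[OF upd[OF f w(1) c(1)] f_C(1)[OF w(1)] _ u(1) ab(1,2,4)])
  qed
  consider "3 \<le> card (F u)" | "card (F u) = 2" using u2 by linarith
  then show ?thesis
  proof cases
    case 1
    \<comment> \<open>Moving a leaf \<open>w\<close> of \<open>u\<close> to \<open>c\<close> leaves
      \<open>u\<close> with at least two leaves and gives \<open>c\<close> a second one, so both are
      exceptional.\<close>
    have only_u: "neighbours E w \<inter> C = {f w}" if w: "w \<in> V - C" for w
    proof (rule ccontr)
      assume ne: "neighbours E w \<inter> C \<noteq> {f w}"
      then have fw: "f w = u" using only[OF w] by blast
      obtain c where c: "c \<in> neighbours E w \<inter> C" "c \<noteq> u" using ne f_C[OF w] fw by blast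
      let ?h = "f(w := c)"
      have "F u - {w} = {t \<in> V - C. ?h t = u}" using c(2) by (auto simp: F_def)
      moreover have "w \<in> F u" using w fw by (simp add: F_def)
      ultimately have hu: "card {t \<in> V - C. ?h t = u} \<noteq> 1"
        using 1 card_Diff_singleton[of w "F u"] by simp
      obtain t where t: "F c = {t}" using F1[of c] c by (auto simp: card_1_singleton_iff)
      then have t': "t \<in> V - C" "f t = c" by (auto simp: F_def)
      then have "t \<noteq> w" using fw c(2) by blast
      moreover have "t \<in> {t \<in> V - C. ?h t = c}" "w \<in> {t \<in> V - C. ?h t = c}"
        using t' w \<open>t \<noteq> w\<close> by simp_all
      ultimately have "2 \<le> card {t \<in> V - C. ?h t = c}"
        using finite_V by (intro two_le_card[of t _ w]) simp_all
      then have "card {t \<in> V - C. ?h t = c} \<noteq> 1" by simp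
      then show False using hu c by (intro key[OF upd[OF f w c(1)] u(1), of c]) simp_all
    qed
    have NF: "neighbours E v \<inter> (V - C) = F v" if v: "v \<in> C" for v
    proof -
      have "w \<in> neighbours E v \<longleftrightarrow> f w = v" if "w \<in> V - C" for w
      proof -
        have "w \<in> neighbours E v \<longleftrightarrow> v \<in> neighbours E w \<inter> C"
          using v neighbours_sym[of w E v] by simp
        then show ?thesis unfolding only_u[OF that] by auto
      qed
      then show ?thesis unfolding F_def by blast
    qed
    \<comment> \<open>By nestedness a neighbour of \<open>w\<close> outside \<open>C\<close> would
      also have the parent \<open>v\<close>, but \<open>v\<close> has only one leaf.\<close>
    have pend: "pendant E w" if v: "v \<in> C" "v \<noteq> u" and w: "w \<in> F v" for v w
    proof -
      have wV: "w \<in> V - C" "f w = v" using w by (auto simp: F_def)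
      have "n = v" if n: "n \<in> neighbours E w" for n
      proof (cases "n \<in> C")
        case True
        then have "n \<in> neighbours E w \<inter> C" using n by simp
        then show ?thesis unfolding only_u[OF wV(1)] wV(2) by simp
      next
        case False
        then have nV: "n \<in> V - C" "n \<noteq> w" using simple_neighbours[OF simple n] by auto
        have "f w \<in> neighbours E n \<inter> C \<or> f n \<in> neighbours E w \<inter> C"
          using neighbours_nested[OF wV(1) nV(1) n] f_C[OF wV(1)] f_C[OF nV(1)] by blast
        then have "f n = v" unfolding only_u[OF wV(1)] only_u[OF nV(1)] using wV(2) by auto
        then have "n \<in> F v" using nV by (simp add: F_def)
        then show ?thesis using F1[OF v] w nV(2) by (auto simp: card_1_singleton_iff)
      qed
      then have "neighbours E w = {v}" using f_C(2)[OF wV(1)] wV(2) by blast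
      then show ?thesis by (simp add: pendant_def vertex_degree_def)
    qed
    have "3 \<le> card (neighbours E u \<inter> (V - C))" using 1 NF[OF u(1)] by simp
    moreover have "card (neighbours E v \<inter> (V - C)) = 1 \<and>
        (\<forall>w \<in> neighbours E v \<inter> (V - C). pendant E w)" if "v \<in> C - {u}" for v
      using NF[of v] F1[of v] pend[of v] that by simp
    ultimately show ?thesis using u(1) by blast
  next
    case 2
    have "{a, b} \<subseteq> F u" using ab f_ab by (simp add: F_def)
    then have Fu: "F u = {a, b}"
      using 2 ab(4) card_subset_eq[OF finF, of "{a, b}" u] by simp
    \<comment> \<open>If both had another possible parent, moving \<open>a\<close> to
      \<open>c\<close> and \<open>b\<close> to \<open>d\<close> would leave \<open>u\<close> without
      leaves, while \<open>c\<close> keeps its own leaf and gains \<open>a\<close>. A vertex seeing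
      only \<open>u\<close> becomes \<open>y0\<close>, the other one \<open>x\<close>.\<close>
    have "neighbours E a \<inter> C = {u} \<or> neighbours E b \<inter> C = {u}"
    proof (rule ccontr)
      assume "\<not> ?thesis"
      then obtain c d where c: "c \<in> neighbours E a \<inter> C" "c \<noteq> u" and d: "d \<in> neighbours E b \<inter> C" "d \<noteq> u"
        using u by blast
      let ?h = "f(a := c, b := d)"
      have "{t \<in> V - C. ?h t = u} \<subseteq> F u - {a, b}" using c(2) d(2) by (auto simp: F_def)
      then have hu: "{t \<in> V - C. ?h t = u} = {}" using Fu by blast
      obtain t where t: "F c = {t}" using F1[of c] c by (auto simp: card_1_singleton_iff)
      then have t': "t \<in> V - C" "f t = c" by (auto simp: F_def)
      then have "t \<noteq> a" "t \<noteq> b" using f_ab c(2) by auto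
      then have "?h t = c" "?h a = c" using t' ab(4) by auto
      then show False
        using key'[OF upd[OF upd[OF f ab(1) c(1)] ab(2) d(1)] u(1) hu _ t'(1) ab(1) \<open>t \<noteq> a\<close>] c(1)
        by blast
    qed
    then obtain x y0 where xy: "F u = {x, y0}" "x \<noteq> y0" "neighbours E y0 \<inter> C = {u}"
      using Fu ab(4) by (metis insert_commute)
    have "x \<in> F u" using xy by simp
    then have x: "x \<in> V - C" "f x = u" by (auto simp: F_def)
    have "\<exists>w. F v - {x} = {w}" if v: "v \<in> C" for v
    proof (cases "v = u")
      case True
      then show ?thesis using xy by blast
    next
      case False
      then obtain w where "F v = {w}" using F1[OF v] by (auto simp: card_1_singleton_iff)
      moreover have "x \<notin> F v" using x False by (simp add: F_def)
      ultimately show ?thesis by blast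
    qed
    then obtain y where y: "\<And>v. v \<in> C \<Longrightarrow> F v - {x} = {y v}" by metis
    have yF: "y v \<in> V - C" "f (y v) = v" "y v \<noteq> x" if "v \<in> C" for v
      using y[OF that] unfolding F_def by blast+
    have "spiked_clique V E C x y"
    proof unfold_locales
      show "x \<in> V - C" by (rule x)
      show "inj_on y C" by (rule inj_on_inverseI[of C f]) (rule yF(2))
      show "x \<notin> y ` C" using yF(3) by blast
      have "w \<in> insert x (y ` C)" if "w \<in> V - C" for w
      proof -
        have "w = x \<or> w \<in> F (f w) - {x}" using that by (simp add: F_def)
        then show ?thesis unfolding y[OF f_C(1)[OF that]] using f_C(1)[OF that] by blast
      qed
      then have "V - C \<subseteq> insert x (y ` C)" by (rule subsetI)
      moreover have "insert x (y ` C) \<subseteq> V - C" using x(1) yF(1) by fast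
      ultimately show "V - C = insert x (y ` C)" by (rule equalityI)
      show "neighbours E (y v) \<inter> C = {v}" if v: "v \<in> C" for v
      proof (cases "v = u")
        case True
        have "F u - {x} = {y0}" using xy(1,2) by blast
        then have "y u = y0" using y[OF u(1)] by simp
        then show ?thesis using xy(3) True by simp
      next
        case False
        then show ?thesis using only[OF yF(1)[OF v]] yF(2)[OF v] by simp
      qed
    qed
    then show ?thesis by blast
  qed
qed

end

theorem theorem5:
  fixes V :: "'a set" and E :: "'a set set" and C Cbar U :: "'a set"
  assumes "simple_graph V E"
    and "chordal E"
    and "graph_diameter V E = 3"
    and "\<not> split_graph V E"
    and "maximal_clique V E C"
    and "dominating_set V E C"
    and "Cbar = V - C"
    and "U = {u \<in> C. card (neighbours E u \<inter> Cbar) = 2}"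
  shows "(\<nexists>T. HIST V E T) \<longleftrightarrow>
    (\<exists>u'\<in>C. card (neighbours E u' \<inter> Cbar) \<ge> 3 \<and>
       (\<forall>u \<in> C - {u'}. card (neighbours E u \<inter> Cbar) = 1 \<and>
          (\<forall>w \<in> neighbours E u \<inter> Cbar. pendant E w)))
    \<or>
    ((\<forall>u\<in>C. card (neighbours E u \<inter> Cbar) \<in> {1, 2}) \<and>
     (\<forall>w \<in> (\<Union>u \<in> C - U. neighbours E u \<inter> Cbar). pendant E w) \<and>
     (card U = 1
      \<or> (card U = 2 \<and> card (\<Inter>u\<in>U. neighbours E u \<inter> Cbar) = 1)
      \<or> (card U \<ge> 3 \<and> inj_on (\<lambda>u. neighbours E u \<inter> Cbar) U
         \<and> card (\<Inter>u\<in>U. neighbours E u \<inter> Cbar) = 1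
         \<and> card (induced_edges E Cbar) = 1)))"
  (is "?no \<longleftrightarrow> ?one \<or> ?two")
proof -
  interpret dominating_clique V E C by unfold_locales (rule assms)+
  note Cb = assms(7) and U = assms(8)
  \<comment> \<open>Without outer edges, \<open>C\<close> and its complement would make the graph
    split.\<close>
  have edge: "induced_edges E (V - C) \<noteq> {}"
  proof
    assume none: "induced_edges E (V - C) = {}"
    have "clique V E C" using maximal unfolding maximal_clique_def by blast
    moreover have "independent_set V E (V - C)"
      using none unfolding independent_set_def induced_edges_def by blast
    moreover have "C \<union> (V - C) = V" "C \<inter> (V - C) = {}" using C_V by blast+
    ultimately have "split_graph V E" unfolding split_graph_def by blast
    then show False using assms(4) by blast
  qed
  have spiked_two: ?two if H: ?no and s: "spiked_clique V E C x y" for x y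
  proof -
    interpret spiked_clique V E C x y by (rule s)
    have UU: "U = neighbours E x \<inter> C" using U_eq by (simp add: U Cb)
    have cases: "card U = 1 \<or> card U = 2 \<or> 3 \<le> card U \<and> card (induced_edges E Cbar) = 1"
      using no_HIST_iff[OF edge] H unfolding UU Cb by blast
    have Int: "card (\<Inter>u\<in>U. neighbours E u \<inter> Cbar) = 1" if "2 \<le> card U"
      using Inter_outer that unfolding UU Cb by simp
    have inj: "inj_on (\<lambda>u. neighbours E u \<inter> Cbar) U" using inj_outer unfolding UU Cb .
    show ?two
    proof (intro conjI)
      show "\<forall>u\<in>C. card (neighbours E u \<inter> Cbar) \<in> {1, 2}"
      proof
        fix u assume "u \<in> C"
        from outer_degree[OF this] show "card (neighbours E u \<inter> Cbar) \<in> {1, 2}"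
          unfolding Cb by simp
      qed
      show "\<forall>w \<in> (\<Union>u \<in> C - U. neighbours E u \<inter> Cbar). pendant E w"
      proof
        fix w assume "w \<in> (\<Union>u \<in> C - U. neighbours E u \<inter> Cbar)"
        then obtain u where u: "u \<in> C - U" "w \<in> neighbours E u \<inter> Cbar" by (rule UN_E)
        then have "u \<in> C" "u \<notin> neighbours E x" unfolding UU by auto
        then show "pendant E w" using u(2) unfolding Cb by (rule outer_pendant)
      qed
      from cases show "card U = 1 \<or> (card U = 2 \<and> card (\<Inter>u\<in>U. neighbours E u \<inter> Cbar) = 1)
        \<or> (card U \<ge> 3 \<and> inj_on (\<lambda>u. neighbours E u \<inter> Cbar) U
         \<and> card (\<Inter>u\<in>U. neighbours E u \<inter> Cbar) = 1 \<and> card (induced_edges E Cbar) = 1)"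
      proof (elim disjE conjE)
        assume "card U = 2"
        then show ?thesis using Int by simp
      next
        assume "3 \<le> card U" "card (induced_edges E Cbar) = 1"
        then show ?thesis using Int inj by linarith
      qed (rule disjI1)
    qed
  qed
  have two_no: ?no if two: ?two
  proof -
    have deg: "card (neighbours E u \<inter> (V - C)) \<in> {1, 2}" if "u \<in> C" for u
      using two that Cb by blast
    have card_U: "card U = 1 \<or> card U = 2 \<or> 3 \<le> card U \<and> card (induced_edges E (V - C)) = 1"
      using two unfolding Cb by argo
    then have "U \<noteq> {}" by auto
    \<comment> \<open>For \<open>card U = 1\<close> either outer neighbour of the single vertex can
      serve as \<open>x\<close>; otherwise \<open>x\<close> is the one common element.\<close>
    have "\<exists>x. (\<forall>u\<in>U. x \<in> neighbours E u \<inter> (V - C)) \<and> inj_on (\<lambda>u. neighbours E u \<inter> (V - C)) U"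
    proof (cases "card U = 1")
      case True
      then obtain u where u: "U = {u}" by (auto simp: card_1_singleton_iff)
      then have "card (neighbours E u \<inter> (V - C)) = 2" using U Cb by auto
      then have "neighbours E u \<inter> (V - C) \<noteq> {}" by auto
      then show ?thesis using u by auto
    next
      case False
      then have "card (\<Inter>u\<in>U. neighbours E u \<inter> (V - C)) = 1" using two unfolding Cb by argo
      then obtain x where x: "(\<Inter>u\<in>U. neighbours E u \<inter> (V - C)) = {x}"
        by (auto simp: card_1_singleton_iff)
      have "inj_on (\<lambda>u. neighbours E u \<inter> (V - C)) U"
      proof (cases "card U = 2")
        case True
        then obtain a b where ab: "U = {a, b}" "a \<noteq> b" by (auto simp: card_2_iff)
        \<comment> \<open>In case 2(b) distinctness is derived: equal outer neighbourhoods would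
          coincide with their intersection \<open>{x}\<close>, but they have two elements.\<close>
        have "neighbours E a \<inter> (V - C) \<noteq> neighbours E b \<inter> (V - C)"
        proof
          assume "neighbours E a \<inter> (V - C) = neighbours E b \<inter> (V - C)"
          then have "neighbours E a \<inter> (V - C) = {x}" using x ab by simp
          moreover have "card (neighbours E a \<inter> (V - C)) = 2" using ab(1) U Cb by blast
          ultimately show False by simp
        qed
        then show ?thesis using ab by simp
      next
        case not2: False
        then show ?thesis using two False unfolding Cb by argo
      qed
      then show ?thesis using x by blast
    qed
    then obtain x where x: "\<And>u. u \<in> U \<Longrightarrow> x \<in> neighbours E u \<inter> (V - C)"
      and inj: "inj_on (\<lambda>u. neighbours E u \<inter> (V - C)) U" by blast
    have UV: "U = {u \<in> C. card (neighbours E u \<inter> (V - C)) = 2}" by (simp add: U Cb)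
    have pend: "pendant E w" if "u \<in> C - U" "w \<in> neighbours E u \<inter> (V - C)" for u w
      using two that unfolding Cb by blast
    have "\<exists>y. spiked_clique V E C x y"
      by (rule spiked_cliqueI[of x, folded UV])
         (erule deg | erule (1) pend | rule inj | erule x | rule \<open>U \<noteq> {}\<close>)+
    then obtain y where s: "spiked_clique V E C x y" by blast
    interpret spiked_clique V E C x y by (rule s)
    have "U = neighbours E x \<inter> C" using U_eq by (simp add: UV)
    then show ?no using no_HIST_iff[OF edge] card_U by simp
  qed
  have one_no: ?no if one: ?one
  proof -
    obtain u' where u': "u' \<in> C" "3 \<le> card (neighbours E u' \<inter> (V - C))"
      and rest: "\<And>u. u \<in> C - {u'} \<Longrightarrow> card (neighbours E u \<inter> (V - C)) = 1 \<and>
          (\<forall>w \<in> neighbours E u \<inter> (V - C). pendant E w)"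
      using one unfolding Cb by blast
    have "neighbours E u' \<inter> (V - C) \<noteq> {}" using u'(2) by auto
    moreover have "\<exists>w. neighbours E u \<inter> (V - C) = {w} \<and> pendant E w" if "u \<in> C - {u'}" for u
      using rest[OF that] by (auto simp: card_1_singleton_iff)
    ultimately show ?no by (rule no_HIST_one_free[OF u'(1)])
  qed
  show ?thesis
  proof
    assume H: ?no
    from no_HIST_cases[OF edge H] show "?one \<or> ?two"
      using spiked_two[OF H] unfolding Cb by blast
  next
    assume "?one \<or> ?two"
    then show ?no using one_no two_no by blast
  qed
qed

end
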